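(* Let $D$ be a differential operator on the group $\mathrm{GL}(2,\mathbb R)$ admitting a polynomial expression in $a$, $b$, $c$, $d$, $(ad-bc)^{-1}$, $\frac{\partial}{\partial a}$, $\frac{\partial}{\partial b}$, $\frac{\partial}{\partial c}$, $\frac{\partial}{\partial d}$, where $a,b,c,d$ are the matrix-entry coordinates. Then its Fourier-image $\Theta(D)$, i.e. the transformation satisfying $K_{DF}=\Theta(D)K_F$ for all $F\in C_0^\infty(\mathrm{GL}(2,\mathbb R))$, is a finite sum of the form $$\Theta(D)=\sum_{k,l}Q_{kl}\Bigl(t,s,\frac{\partial}{\partial t},\frac{\partial}{\partial s}\Bigr)V_1^kV_2^l,$$ where $k,l\in\mathbb Z$ and the $Q_{kl}(\cdot)$ are polynomial expressions in $t,s,\frac{\partial}{\partial t},\frac{\partial}{\partial s}$ whose coefficients are rational functions of $\mu_1,\mu_2$ with poles at lines $\mu_1-\mu_2=m$, $m\in\mathbb Z$.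
   Context: $C_0^\infty(\mathrm{GL}(2,\mathbb R))$ is the space of compactly supported smooth (complex-valued) functions on the group $\mathrm{GL}(2,\mathbb R)$ of real invertible matrices $\begin{pmatrix}a&b\\c&d\end{pmatrix}$; such a function is written $F(a,b,c,d)$ and is regarded as $0$ where $ad-bc=0$. For $\mu\in\mathbb C$, $\epsilon\in\mathbb Z_2=\mathbb Z/2\mathbb Z$ and $x\in\mathbb R\setminus\{0\}$ put $x^{\mu/\!\!/\epsilon}:=|x|^\mu\,\mathrm{sgn}(x)^\epsilon$ (in an expression such as $x^{-3/2+\mu_1/\!\!/\epsilon_1}$ the exponent of $|x|$ is $-3/2+\mu_1$ and the parity is $\epsilon_1$). Representations: for $(\mu_1,\epsilon_1,\mu_2,\epsilon_2)\in\Lambda:=\mathbb C\times\mathbb Z_2\times\mathbb C\times\mathbb Z_2$, $$T_{\mu_1,\epsilon_1;\mu_2,\epsilon_2}\begin{pmatrix}a&b\\c&d\end{pmatrix}\varphi(t)=\varphi\Bigl(\frac{b+td}{a+tc}\Bigr)(a+tc)^{-1+\mu_1-\mu_2/\!\!/\epsilon_1-\epsilon_2}\,(ad-bc)^{1/2+\mu_2/\!\!/\epsilon_2},$$ acting on smooth functions $\varphi$ on $\mathbb R$ such that $\varphi(-t^{-1})(-t)^{-1+\mu_1-\mu_2/\!\!/\epsilon_1-\epsilon_2}$ is smooth at $0$. Fourier transform: $F\in C_0^\infty(\mathrm{GL}(2,\mathbb R))$ is sent to the operator-valued function on $\Lambda$ given by $T_{\mu_1,\epsilon_1;\mu_2,\epsilon_2}(F)=\int_{\mathrm{GL}(2,\mathbb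 R)}F(g)\,T_{\mu_1,\epsilon_1;\mu_2,\epsilon_2}(g)\,dg$, where $dg=(ad-bc)^{-2}\,da\,db\,dc\,dd$ is the Haar measure. These are integral operators $T_{\mu_1,\epsilon_1;\mu_2,\epsilon_2}(F)f(t)=\int_{\mathbb R}K_F(t,s|\mu_1,\epsilon_1;\mu_2,\epsilon_2)f(s)\,ds$ with kernel $$K_F(t,s|\mu_1,\epsilon_1;\mu_2,\epsilon_2)=\iiint_{\mathbb R^3}F\bigl(u-tv,\;su-stv-tw,\;v,\;sv+w\bigr)\,u^{-3/2+\mu_1/\!\!/\epsilon_1}\,w^{-3/2+\mu_2/\!\!/\epsilon_2}\,du\,dv\,dw .$$ The kernel $K_F$ is smooth in $t,s\in\mathbb R$ and holomorphic in $\mu_1,\mu_2\in\mathbb C$. The space of all operator-valued functions obtained in this way (equivalently, of their kernels) is denoted $\mathcal E$; the Fourier-image of a differential operator $D$ on $C_0^\infty(\mathrm{GL}(2,\mathbb R))$ is the transformation $\Theta(D)$ in $\mathcal E$ with $K_{DF}=\Theta(D)K_F$ for all $F$. Shift operators: $$V_1K(t,s|\mu_1,\epsilon_1;\mu_2,\epsilon_2)=K(t,s|\mu_1+1,\epsilon_1+1;\mu_2,\epsilon_2),\qquad V_2K(t,s|\mu_1,\epsilon_1;\mu_2,\epsilon_2)=K(t,s|\mu_1,\epsilon_1;\mu_2+1,\epsilon_2+1),$$ and $V_1^{k},V_2^{l}$ for $k,l\in\mathbb Z$ are their integer powers. Compositions of operators are read right to left: the shifts are applied first, then $Q_{kl}$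 with its coefficients evaluated at the (unshifted) point $(\mu_1,\mu_2)$. "Polynomial expression" in operators means a noncommutative polynomial with complex coefficients. "Poles at lines $\mu_1-\mu_2=m$" means that the polar set of each coefficient is contained in a union of finitely many such lines with $m\in\mathbb Z$. The identity $K_{DF}=\Theta(D)K_F$ is an identity of meromorphic functions of $(\mu_1,\mu_2)$, i.e. an equality at all points outside the poles of the coefficients. *)

theory Defs
  imports
    "HOL-Analysis.Analysis"
    "HOL-Computational_Algebra.Computational_Algebra"
    "HOL-Computational_Algebra.Field_as_Ring"
    "HOL-Library.Poly_Mapping"
    "HOL-Library.Z2"
begin

section \<open>Test functions on GL(2,R)\<close>

definition GL2 :: "(real^2^2) set" where
  "GL2 = {A. invertible A}"

definition mat2 :: "real \<Rightarrow> real \<Rightarrow> real \<Rightarrow> real \<Rightarrow> real^2^2" where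
  "mat2 a b c d = vector [vector [a, b], vector [c, d]]"

text \<open>
  Continuous differentiability of order \<open>n\<close> on an open subset of a finite-dimensional space:
  all iterated directional derivatives up to order \<open>n\<close> exist and are continuous.
\<close>

primrec Ck_on :: "nat \<Rightarrow> 'a::euclidean_space set \<Rightarrow> ('a \<Rightarrow> 'b::real_normed_vector) \<Rightarrow> bool" where
  "Ck_on 0 S f \<longleftrightarrow> continuous_on S f"
| "Ck_on (Suc n) S f \<longleftrightarrow>
     (\<forall>x\<in>S. f differentiable (at x)) \<and> (\<forall>v. Ck_on n S (\<lambda>x. frechet_derivative f (at x) v))"

definition smooth_on :: "'a::euclidean_space set \<Rightarrow> ('a \<Rightarrow> 'b::real_normed_vector) \<Rightarrow> bool" where
  "smooth_on S f \<longleftrightarrow> (\<forall>n. Ck_on n S f)"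

text \<open>
  A function on the group is represented by its extension by \<open>0\<close> to all matrices.  The support is
  a compact subset of the group itself, hence stays away from the singular matrices.
\<close>

definition test_functions :: "(real^2^2 \<Rightarrow> complex) set" where
  "test_functions =
     {F. smooth_on GL2 F \<and> (\<exists>C. compact C \<and> C \<subseteq> GL2 \<and> (\<forall>A. A \<notin> C \<longrightarrow> F A = 0))}"


section \<open>The kernel of the Fourier transform\<close>

text \<open>The parity group is the type \<^typ>\<open>bit\<close> of integers modulo 2; used only for \<open>x \<noteq> 0\<close>.\<close>

definition signed_powr :: "real \<Rightarrow> complex \<Rightarrow> bit \<Rightarrow> complex" where
  "signed_powr x \<mu> \<epsilon> = of_real \<bar>x\<bar> powr \<mu> * (if \<epsilon> = 0 then 1 else of_real (sgn x))"

text \<open>Arguments in the order \<open>t\<close>, \<open>s\<close>, \<open>\<mu>\<^sub>1\<close>, \<open>\<epsilon>\<^sub>1\<close>, \<open>\<mu>\<^sub>2\<close>, \<open>\<epsilon>\<^sub>2\<close>.\<close>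

type_synonym kernel = "real \<Rightarrow> real \<Rightarrow> complex \<Rightarrow> bit \<Rightarrow> complex \<Rightarrow> bit \<Rightarrow> complex"

text \<open>
  The determinant of the matrix below is \<open>u * w\<close>, so the integrand vanishes near \<open>u * w = 0\<close> and
  the values of the powers at \<open>0\<close> are irrelevant.
\<close>

definition fourier_kernel :: "(real^2^2 \<Rightarrow> complex) \<Rightarrow> kernel" where
  "fourier_kernel F t s \<mu>1 \<epsilon>1 \<mu>2 \<epsilon>2 =
     (LINT (u, v, w)|lborel.
        F (mat2 (u - t * v) (s * u - s * t * v - t * w) v (s * v + w)) *
        signed_powr u (- 3/2 + \<mu>1) \<epsilon>1 * signed_powr w (- 3/2 + \<mu>2) \<epsilon>2)"


section \<open>Polynomial differential operators on GL(2,R)\<close>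

text \<open>
  A noncommutative polynomial with coefficients in \<open>'c\<close> and indeterminates in \<open>'g\<close> is a finitely
  supported function from words to coefficients, \<^typ>\<open>'g list \<Rightarrow>\<^sub>0 'c\<close>.
  A word \<open>[x\<^sub>1, \<dots>, x\<^sub>n]\<close> stands for the composition \<open>x\<^sub>1 \<circ> \<dots> \<circ> x\<^sub>n\<close>.
\<close>

datatype gl2_gen = Entry 2 2 | Inv_det | Partial 2 2

primrec gl2_act :: "gl2_gen \<Rightarrow> (real^2^2 \<Rightarrow> complex) \<Rightarrow> (real^2^2 \<Rightarrow> complex)" where
  "gl2_act (Entry i j) F = (\<lambda>A. of_real (A $ i $ j) * F A)"
| "gl2_act Inv_det F = (\<lambda>A. of_real (inverse (det A)) * F A)"
| "gl2_act (Partial i j) F = (\<lambda>A. frechet_derivative F (at A) (axis i (axis j 1)))"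

definition gl2_poly_op ::
    "(gl2_gen list \<Rightarrow>\<^sub>0 complex) \<Rightarrow> (real^2^2 \<Rightarrow> complex) \<Rightarrow> (real^2^2 \<Rightarrow> complex)" where
  "gl2_poly_op P F =
     (\<lambda>A. \<Sum>x\<in>Poly_Mapping.keys P. Poly_Mapping.lookup P x * foldr gl2_act x F A)"

text \<open>An operator matters only through its action on test functions.\<close>

definition polynomial_diff_op :: "((real^2^2 \<Rightarrow> complex) \<Rightarrow> (real^2^2 \<Rightarrow> complex)) \<Rightarrow> bool" where
  "polynomial_diff_op D \<longleftrightarrow> (\<exists>P. \<forall>F\<in>test_functions. D F = gl2_poly_op P F)"


section \<open>Rational functions of two complex variables\<close>

text \<open>
  The outer indeterminate of \<^typ>\<open>complex poly poly\<close> is \<open>\<mu>\<^sub>1\<close>, the inner one is \<open>\<mu>\<^sub>2\<close>.  Numerator and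
  denominator are taken in lowest terms, so that the polar set is the zero set of the denominator.
\<close>

type_synonym ratfun = "complex poly poly fract"

definition poly2 :: "complex poly poly \<Rightarrow> complex \<Rightarrow> complex \<Rightarrow> complex" where
  "poly2 p \<mu>1 \<mu>2 = poly (poly p [:\<mu>1:]) \<mu>2"

definition ratfun_eval :: "ratfun \<Rightarrow> complex \<Rightarrow> complex \<Rightarrow> complex" where
  "ratfun_eval r \<mu>1 \<mu>2 =
     poly2 (fst (quot_of_fract r)) \<mu>1 \<mu>2 / poly2 (snd (quot_of_fract r)) \<mu>1 \<mu>2"

definition polar_set :: "ratfun \<Rightarrow> (complex \<times> complex) set" where
  "polar_set r = {(\<mu>1, \<mu>2). poly2 (snd (quot_of_fract r)) \<mu>1 \<mu>2 = 0}"

definition poles_at_integer_lines :: "ratfun \<Rightarrow> bool" where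
  "poles_at_integer_lines r \<longleftrightarrow>
     (\<exists>M :: int set. finite M \<and> polar_set r \<subseteq> (\<Union>m\<in>M. {(\<mu>1, \<mu>2). \<mu>1 - \<mu>2 = of_int m}))"


section \<open>Differential-difference operators on kernels\<close>

definition V1 :: "kernel \<Rightarrow> kernel" where
  "V1 K = (\<lambda>t s \<mu>1 \<epsilon>1 \<mu>2 \<epsilon>2. K t s (\<mu>1 + 1) (\<epsilon>1 + 1) \<mu>2 \<epsilon>2)"

definition V2 :: "kernel \<Rightarrow> kernel" where
  "V2 K = (\<lambda>t s \<mu>1 \<epsilon>1 \<mu>2 \<epsilon>2. K t s \<mu>1 \<epsilon>1 (\<mu>2 + 1) (\<epsilon>2 + 1))"

text \<open>Integer powers of a bijective operator.\<close>

definition int_funpow :: "('a \<Rightarrow> 'a) \<Rightarrow> int \<Rightarrow> 'a \<Rightarrow> 'a" where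
  "int_funpow f k = (if 0 \<le> k then f ^^ nat k else inv f ^^ nat (- k))"

datatype ts_gen = Mult_t | Mult_s | Diff_t | Diff_s

primrec ts_act :: "ts_gen \<Rightarrow> (real \<Rightarrow> real \<Rightarrow> complex) \<Rightarrow> (real \<Rightarrow> real \<Rightarrow> complex)" where
  "ts_act Mult_t f = (\<lambda>t s. of_real t * f t s)"
| "ts_act Mult_s f = (\<lambda>t s. of_real s * f t s)"
| "ts_act Diff_t f = (\<lambda>t s. vector_derivative (\<lambda>x. f x s) (at t))"
| "ts_act Diff_s f = (\<lambda>t s. vector_derivative (\<lambda>x. f t x) (at s))"

text \<open>
  The coefficients commute with \<open>t\<close>, \<open>s\<close> and the derivatives in \<open>t\<close>, \<open>s\<close>, hence may be written
  on the left of every word.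
\<close>

definition ts_poly_op :: "(ts_gen list \<Rightarrow>\<^sub>0 ratfun) \<Rightarrow> kernel \<Rightarrow> kernel" where
  "ts_poly_op Q K = (\<lambda>t s \<mu>1 \<epsilon>1 \<mu>2 \<epsilon>2.
     \<Sum>x\<in>Poly_Mapping.keys Q. ratfun_eval (Poly_Mapping.lookup Q x) \<mu>1 \<mu>2 *
        foldr ts_act x (\<lambda>t' s'. K t' s' \<mu>1 \<epsilon>1 \<mu>2 \<epsilon>2) t s)"

definition shift_poly_op ::
    "(int \<times> int) set \<Rightarrow> (int \<Rightarrow> int \<Rightarrow> (ts_gen list \<Rightarrow>\<^sub>0 ratfun)) \<Rightarrow> kernel \<Rightarrow> kernel" where
  "shift_poly_op I Q K = (\<lambda>t s \<mu>1 \<epsilon>1 \<mu>2 \<epsilon>2.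
     \<Sum>(k, l)\<in>I. ts_poly_op (Q k l) (int_funpow V1 k (int_funpow V2 l K)) t s \<mu>1 \<epsilon>1 \<mu>2 \<epsilon>2)"

definition coeff_poles ::
    "(int \<times> int) set \<Rightarrow> (int \<Rightarrow> int \<Rightarrow> (ts_gen list \<Rightarrow>\<^sub>0 ratfun)) \<Rightarrow> (complex \<times> complex) set" where
  "coeff_poles I Q =
     (\<Union>(k, l)\<in>I. \<Union>x\<in>Poly_Mapping.keys (Q k l). polar_set (Poly_Mapping.lookup (Q k l) x))"

text \<open>
  \<open>\<Theta>\<close> is the Fourier-image of \<open>D\<close>, as an identity of meromorphic functions of
  \<open>(\<mu>\<^sub>1, \<mu>\<^sub>2)\<close> that may have poles on the set \<open>Z\<close>.
\<close>

definition is_fourier_image ::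
    "((real^2^2 \<Rightarrow> complex) \<Rightarrow> (real^2^2 \<Rightarrow> complex)) \<Rightarrow> (complex \<times> complex) set \<Rightarrow>
     (kernel \<Rightarrow> kernel) \<Rightarrow> bool" where
  "is_fourier_image D Z \<Theta> \<longleftrightarrow>
     (\<forall>F\<in>test_functions. \<forall>t s \<mu>1 \<epsilon>1 \<mu>2 \<epsilon>2. (\<mu>1, \<mu>2) \<notin> Z \<longrightarrow>
        fourier_kernel (D F) t s \<mu>1 \<epsilon>1 \<mu>2 \<epsilon>2 = \<Theta> (fourier_kernel F) t s \<mu>1 \<epsilon>1 \<mu>2 \<epsilon>2)"

end

theory Submission
  imports Defs
begin

text \<open>
  It suffices to treat the generators. If \<open>K\<close> is the kernel of a test function \<open>F\<close> and each of the
  nine generators turns \<open>K\<close> into a differential-difference expression in \<open>K\<close>, then a word in the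
  generators is handled one letter at a time, because test functions are closed under the generators
  and the admissible expressions are closed under \<open>t\<close>, \<open>s\<close>, \<open>\<partial>/\<partial>t\<close>, \<open>\<partial>/\<partial>s\<close>, the shifts, and rational
  coefficients with poles at integer lines.

  Write the matrix in the kernel integral as \<open>a = u - tv\<close>, \<open>b = su - stv - tw\<close>, \<open>c = v\<close>, \<open>d = sv + w\<close>, so
  that \<open>ad - bc = uw\<close>. Multiplication of the integrand by \<open>u\<close> and \<open>w\<close> is \<open>V\<^sub>1\<close> and \<open>V\<^sub>2\<close>, which disposes of
  \<open>(ad - bc)\<^sup>-\<^sup>1\<close> and reduces \<open>a\<close>, \<open>b\<close>, \<open>d\<close> to \<open>c = v\<close>. For \<open>v\<close> one uses that the matrix depends on five
  parameters but has four entries, so that the five derivatives of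
  \<open>G(t,s,u,v,w) = F(a,b,c,d)\<close> satisfy one linear relation:
  \<open>u \<partial>\<^sub>tG + w \<partial>\<^sub>sG = v (w \<partial>\<^sub>wG - u \<partial>\<^sub>uG)\<close>.
  Integrating it against \<open>u\<^sup>\<alpha> w\<^sup>\<beta>\<close> with \<open>\<alpha> = -3/2 + \<mu>\<^sub>1\<close>, \<open>\<beta> = -3/2 + \<mu>\<^sub>2\<close>, and by parts on the right, gives
  \<open>(\<mu>\<^sub>1 - \<mu>\<^sub>2) K\<^sub>c\<^sub>F = (\<partial>\<^sub>t V\<^sub>1 + \<partial>\<^sub>s V\<^sub>2) K\<^sub>F\<close> (\<open>fourier_kernel_entry21\<close>). This division is the only source of poles;
  shifts move the line \<open>\<mu>\<^sub>1 = \<mu>\<^sub>2\<close> to other integer lines. The partial derivatives follow in the same way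
  from \<open>\<partial>\<^sub>sG = u F\<^sub>b + v \<partial>\<^sub>wG\<close> (\<open>fourier_kernel_partial12\<close>) and from integration by parts in \<open>u\<close>, \<open>v\<close>, \<open>w\<close>
  (\<open>fourier_kernel_by_parts\<close>).

  The differential calculus of the kernel is contained in one differentiation under the integral sign
  (\<open>fourier_kernel_flow_derivative\<close>), where \<open>t\<close>, \<open>s\<close> and the integration variables move together with
  constant velocities: moving \<open>t\<close> or \<open>s\<close> alone gives the derivatives of the kernel, moving \<open>u\<close>, \<open>v\<close>, \<open>w\<close>
  alone gives integration by parts.

  The construction yields the identity outside finitely many lines that contain all poles of
  the coefficients. When terms are collected, poles may cancel; on such a line the identity is recovered by
  continuity in \<open>\<mu>\<^sub>1\<close>.
\<close>

(* The dollar sign denotes entries of matrices only. *)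
no_notation fps_nth (infixl "$" 75)


section \<open>Calculus of smooth functions\<close>

lemma Ck_on_const: "Ck_on n S (\<lambda>_. c)"
  by (induction n arbitrary: c) (auto simp: frechet_derivative_const)

text \<open>
  Openness is essential: the derivative at a point of \<open>S\<close> must only see the values of the function in \<open>S\<close>.
\<close>

lemma Ck_on_cong:
  assumes "open S" and "\<And>x. x \<in> S \<Longrightarrow> f x = g x" and "Ck_on n S f"
  shows "Ck_on n S g"
  using assms(2,3)
proof (induction n arbitrary: f g)
  case 0
  then show ?case by (auto cong: continuous_on_cong)
next
  case (Suc n)
  have deriv: "(f has_derivative D) (at x) \<longleftrightarrow> (g has_derivative D) (at x)" if "x \<in> S" for x D
    using has_derivative_transform_within_open[OF _ assms(1) that, of f D UNIV g]
      has_derivative_transform_within_open[OF _ assms(1) that, of g D UNIV f] Suc.prems(1)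
    by auto
  have "g differentiable (at x)" if "x \<in> S" for x
    using Suc.prems(2) deriv[OF that] that unfolding Ck_on.simps differentiable_def by metis
  moreover have "frechet_derivative f (at x) = frechet_derivative g (at x)" if "x \<in> S" for x
    using deriv[OF that] by (simp add: frechet_derivative_def)
  then have "Ck_on n S (\<lambda>x. frechet_derivative g (at x) v)" for v
    using Suc.IH[of "\<lambda>x. frechet_derivative f (at x) v" "\<lambda>x. frechet_derivative g (at x) v"] Suc.prems(2)
    by simp
  ultimately show ?case by simp
qed

lemma Ck_on_Suc_imp_continuous: "Ck_on (Suc n) S f \<Longrightarrow> continuous_on S f"
  by (auto intro!: continuous_at_imp_continuous_on differentiable_imp_continuous_within)

lemma Ck_on_mono: "Ck_on (Suc n) S f \<Longrightarrow> Ck_on n S f"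
proof (induction n arbitrary: f)
  case 0
  then show ?case using Ck_on_Suc_imp_continuous[of 0 S f] by simp
qed auto

lemma frechet_derivative_add:
  assumes "f differentiable (at x)" "g differentiable (at x)"
  shows "frechet_derivative (\<lambda>x. f x + g x) (at x) v
           = frechet_derivative f (at x) v + frechet_derivative g (at x) v"
proof -
  have "((\<lambda>x. f x + g x) has_derivative (\<lambda>v. frechet_derivative f (at x) v + frechet_derivative g (at x) v)) (at x)"
    using assms by (intro has_derivative_add) (auto simp: frechet_derivative_works[symmetric])
  from frechet_derivative_at[OF this] show ?thesis by metis
qed

lemma Ck_on_add:
  assumes "open S" and "Ck_on n S f" and "Ck_on n S g"
  shows "Ck_on n S (\<lambda>x. f x + g x)"
  using assms(2,3)
proof (induction n arbitrary: f g)
  case (Suc n)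
  have "Ck_on n S (\<lambda>x. frechet_derivative (\<lambda>x. f x + g x) (at x) v)" for v
    by (rule Ck_on_cong[OF assms(1) _ Suc.IH[of "\<lambda>x. frechet_derivative f (at x) v" "\<lambda>x. frechet_derivative g (at x) v"]])
       (use Suc.prems in \<open>auto simp: frechet_derivative_add\<close>)
  with Suc.prems show ?case by auto
qed (auto intro: continuous_intros)

lemma frechet_derivative_mult:
  fixes f g :: "'a::euclidean_space \<Rightarrow> complex"
  assumes "f differentiable (at x)" "g differentiable (at x)"
  shows "frechet_derivative (\<lambda>x. f x * g x) (at x) v
           = f x * frechet_derivative g (at x) v + frechet_derivative f (at x) v * g x"
proof -
  have "((\<lambda>x. f x * g x) has_derivative (\<lambda>v. f x * frechet_derivative g (at x) v + frechet_derivative f (at x) v * g x)) (at x)"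
    using assms by (intro has_derivative_mult) (auto simp: frechet_derivative_works[symmetric])
  from frechet_derivative_at[OF this] show ?thesis by metis
qed

lemma Ck_on_mult:
  fixes f g :: "'a::euclidean_space \<Rightarrow> complex"
  assumes "open S" and "Ck_on n S f" and "Ck_on n S g"
  shows "Ck_on n S (\<lambda>x. f x * g x)"
  using assms(2,3)
proof (induction n arbitrary: f g)
  case (Suc n)
  have "Ck_on n S (\<lambda>x. frechet_derivative (\<lambda>x. f x * g x) (at x) v)" for v
  proof (rule Ck_on_cong[OF assms(1)])
    show "Ck_on n S (\<lambda>x. f x * frechet_derivative g (at x) v + frechet_derivative f (at x) v * g x)"
      using Suc.prems Ck_on_mono[of n S f] Ck_on_mono[of n S g]
      by (intro Ck_on_add assms(1) Suc.IH) auto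
  qed (use Suc.prems in \<open>auto simp: frechet_derivative_mult\<close>)
  with Suc.prems show ?case by auto
qed (auto intro: continuous_intros)

lemma Ck_on_inverse:
  fixes f :: "'a::euclidean_space \<Rightarrow> complex"
  assumes "open S" and nz: "\<And>x. x \<in> S \<Longrightarrow> f x \<noteq> 0" and "Ck_on n S f"
  shows "Ck_on n S (\<lambda>x. inverse (f x))"
  using assms(3)
proof (induction n)
  case 0
  then show ?case using nz by (auto intro!: continuous_intros)
next
  case (Suc n)
  let ?i = "\<lambda>x. inverse (f x)"
  have D: "(?i has_derivative (\<lambda>v. - (?i x * frechet_derivative f (at x) v * ?i x))) (at x)"
    if "x \<in> S" for x
    by (rule Deriv.has_derivative_inverse) (use Suc.prems nz that in \<open>auto simp: frechet_derivative_works[symmetric]\<close>)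
  have "?i differentiable (at x)" if "x \<in> S" for x
    using D[OF that] by (auto simp: differentiable_def)
  moreover have "Ck_on n S (\<lambda>x. frechet_derivative ?i (at x) v)" for v
  proof (rule Ck_on_cong[OF assms(1)])
    have IH: "Ck_on n S ?i" using Suc.IH Suc.prems Ck_on_mono by blast
    show "Ck_on n S (\<lambda>x. (- 1) * (?i x * frechet_derivative f (at x) v * ?i x))"
      using Suc.prems by (intro Ck_on_mult assms(1) Ck_on_const IH) auto
    show "(- 1) * (?i x * frechet_derivative f (at x) v * ?i x) = frechet_derivative ?i (at x) v"
      if "x \<in> S" for x
      using frechet_derivative_at[OF D[OF that]] by (metis mult_minus1)
  qed
  ultimately show ?case by simp
qed

lemma smooth_on_bounded_linear:
  assumes "bounded_linear f" shows "smooth_on S f"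
  unfolding smooth_on_def
proof
  fix n
  have D: "(f has_derivative f) (at x)" for x
    using assms by (rule bounded_linear_imp_has_derivative)
  have "frechet_derivative f (at x) = f" for x
    using frechet_derivative_at[OF D] by simp
  moreover have "f differentiable (at x)" for x using D by (auto simp: differentiable_def)
  ultimately show "Ck_on n S f"
    using assms by (cases n) (auto simp: Ck_on_const linear_continuous_on)
qed

lemma smooth_on_mult:
  fixes f g :: "'a::euclidean_space \<Rightarrow> complex"
  shows "open S \<Longrightarrow> smooth_on S f \<Longrightarrow> smooth_on S g \<Longrightarrow> smooth_on S (\<lambda>x. f x * g x)"
  by (simp add: smooth_on_def Ck_on_mult)

lemma smooth_on_partial:
  "smooth_on S f \<Longrightarrow> smooth_on S (\<lambda>x. frechet_derivative f (at x) v)"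
  unfolding smooth_on_def by (metis Ck_on.simps(2))


section \<open>Test functions\<close>

lemma GL2_eq: "GL2 = {A. det A \<noteq> 0}"
  by (auto simp: GL2_def invertible_det_nz)

lemma open_GL2: "open GL2"
proof -
  have "open {A :: real^2^2. A $ 1 $ 1 * A $ 2 $ 2 - A $ 1 $ 2 * A $ 2 $ 1 \<noteq> 0}"
    by (intro open_Collect_neq continuous_intros)
  then show ?thesis by (simp add: GL2_eq det_2)
qed

lemma smooth_on_entry: "smooth_on S (\<lambda>A :: real^2^2. complex_of_real (A $ i $ j))"
proof -
  have "bounded_linear (\<lambda>A :: real^2^2. complex_of_real (A $ i $ j))"
    by (intro bounded_linear_compose[OF bounded_linear_of_real]
        bounded_linear_compose[OF bounded_linear_vec_nth bounded_linear_vec_nth])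
  then show ?thesis by (rule smooth_on_bounded_linear)
qed

lemma smooth_on_inverse_det: "smooth_on GL2 (\<lambda>A :: real^2^2. complex_of_real (inverse (det A)))"
proof -
  have "Ck_on n GL2 (\<lambda>A :: real^2^2. complex_of_real (A $ 1 $ 1) * complex_of_real (A $ 2 $ 2)
          + (- 1) * (complex_of_real (A $ 1 $ 2) * complex_of_real (A $ 2 $ 1)))" for n
    using smooth_on_entry[of GL2]
    by (intro Ck_on_add Ck_on_mult open_GL2 Ck_on_const) (auto simp: smooth_on_def)
  then have "Ck_on n GL2 (\<lambda>A :: real^2^2. complex_of_real (det A))" for n
    by (simp add: det_2)
  then show ?thesis
    using Ck_on_inverse[OF open_GL2, of "\<lambda>A. complex_of_real (det A)"]
    by (simp add: smooth_on_def GL2_eq of_real_inverse)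
qed

lemma test_functionE:
  assumes "F \<in> test_functions"
  obtains C where "compact C" "C \<subseteq> GL2" "\<And>A. A \<notin> C \<Longrightarrow> F A = 0"
  using assms by (auto simp: test_functions_def)

lemma test_function_singular: "F \<in> test_functions \<Longrightarrow> det A = 0 \<Longrightarrow> F A = 0"
  by (elim test_functionE) (auto simp: GL2_eq)

text \<open>
  Since \<open>C\<close> is closed, the function vanishes in a neighbourhood of each point outside \<open>C\<close>. Hence test functions
  are differentiable at all matrices, including the singular ones, and the partial derivatives
  of a test function are supported in the same compact set.
\<close>

lemma has_derivative_zero_outside:
  fixes F :: "'a::euclidean_space \<Rightarrow> complex"
  assumes "compact C" and "\<And>A. A \<notin> C \<Longrightarrow> F A = 0" and "A \<notin> C"
  shows "(F has_derivative (\<lambda>_. 0)) (at A)"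
  by (rule has_derivative_transform_within_open[OF has_derivative_const[of 0], of "- C"])
     (use assms in \<open>auto simp: compact_imp_closed open_Compl\<close>)

lemma test_function_differentiable:
  assumes "F \<in> test_functions"
  shows "F differentiable (at A)"
proof -
  obtain C where C: "compact C" "C \<subseteq> GL2" "\<And>A. A \<notin> C \<Longrightarrow> F A = 0"
    using assms by (rule test_functionE) blast
  show ?thesis
  proof (cases "A \<in> GL2")
    case True
    have "Ck_on 1 GL2 F" using assms by (auto simp: test_functions_def smooth_on_def)
    then show ?thesis using True by simp
  next
    case False
    then have "A \<notin> C" using C(2) by blast
    then show ?thesis using has_derivative_zero_outside[OF C(1), of F A] C(3)
      unfolding differentiable_def by metis
  qed
qed

lemma test_function_continuous: "F \<in> test_functions \<Longrightarrow> continuous_on UNIV F"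
  by (auto intro!: continuous_at_imp_continuous_on differentiable_imp_continuous_within
      test_function_differentiable)

lemma test_function_mult:
  assumes "F \<in> test_functions" and "smooth_on GL2 f"
  shows "(\<lambda>A. f A * F A) \<in> test_functions"
  using assms smooth_on_mult[OF open_GL2, of f F] by (auto simp: test_functions_def)

text \<open>
  This is what makes an induction along words of generators possible.
\<close>

lemma test_function_act:
  assumes "F \<in> test_functions"
  shows "gl2_act g F \<in> test_functions"
proof (cases g)
  case (Entry i j)
  then show ?thesis using test_function_mult[OF assms smooth_on_entry[of GL2 i j]] by simp
next
  case Inv_det
  then show ?thesis using test_function_mult[OF assms smooth_on_inverse_det] by simp
next
  case (Partial i j)
  obtain C where C: "compact C" "C \<subseteq> GL2" "\<And>A. A \<notin> C \<Longrightarrow> F A = 0"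
    using assms by (rule test_functionE) blast
  have "frechet_derivative F (at A) v = 0" if "A \<notin> C" for A v
    using frechet_derivative_at[OF has_derivative_zero_outside[OF C(1) _ that, of F]] C(3) by metis
  moreover have "smooth_on GL2 (\<lambda>A. frechet_derivative F (at A) (axis i (axis j 1)))"
    using assms by (intro smooth_on_partial) (simp add: test_functions_def)
  ultimately show ?thesis using C(1,2) Partial by (auto simp: test_functions_def)
qed

lemma test_function_word: "F \<in> test_functions \<Longrightarrow> foldr gl2_act x F \<in> test_functions"
  by (induction x) (simp_all add: test_function_act)

lemma test_function_add:
  assumes "F \<in> test_functions" and "G \<in> test_functions"
  shows "(\<lambda>A. F A + G A) \<in> test_functions"
proof -
  obtain C where C: "compact C" "C \<subseteq> GL2" "\<And>A. A \<notin> C \<Longrightarrow> F A = 0"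
    using assms(1) by (rule test_functionE) blast
  obtain C' where C': "compact C'" "C' \<subseteq> GL2" "\<And>A. A \<notin> C' \<Longrightarrow> G A = 0"
    using assms(2) by (rule test_functionE) blast
  have "smooth_on GL2 (\<lambda>A. F A + G A)"
    using assms open_GL2 by (auto simp: test_functions_def smooth_on_def intro: Ck_on_add)
  moreover have "compact (C \<union> C')" "C \<union> C' \<subseteq> GL2" "\<And>A. A \<notin> C \<union> C' \<Longrightarrow> F A + G A = 0"
    using C C' by (auto intro: compact_Un)
  ultimately show ?thesis unfolding test_functions_def by blast
qed

lemma test_function_scale:
  "F \<in> test_functions \<Longrightarrow> (\<lambda>A. c * F A) \<in> test_functions"
  by (rule test_function_mult) (simp_all add: smooth_on_def Ck_on_const)

lemma test_function_zero: "(\<lambda>_. 0) \<in> test_functions"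
  by (auto simp: test_functions_def smooth_on_def Ck_on_const intro!: exI[of _ "{}"])

lemma test_function_sum:
  assumes "\<And>x. x \<in> X \<Longrightarrow> G x \<in> test_functions"
  shows "(\<lambda>A. \<Sum>x\<in>X. G x A) \<in> test_functions"
  using assms
  by (induction X rule: infinite_finite_induct) (simp_all add: test_function_zero test_function_add)

abbreviation entry :: "2 \<Rightarrow> 2 \<Rightarrow> (real^2^2 \<Rightarrow> complex) \<Rightarrow> (real^2^2 \<Rightarrow> complex)" where
  "entry i j F \<equiv> gl2_act (Entry i j) F"

abbreviation partial :: "2 \<Rightarrow> 2 \<Rightarrow> (real^2^2 \<Rightarrow> complex) \<Rightarrow> (real^2^2 \<Rightarrow> complex)" where
  "partial i j F \<equiv> gl2_act (Partial i j) F"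

lemma mat2_nth [simp]:
  "mat2 a b c d $ 1 $ 1 = a" "mat2 a b c d $ 1 $ 2 = b"
  "mat2 a b c d $ 2 $ 1 = c" "mat2 a b c d $ 2 $ 2 = d"
  by (simp_all add: mat2_def)

lemma det_mat2 [simp]: "det (mat2 a b c d) = a * d - b * c"
  by (simp add: det_2)

lemma mat2_eq_axis:
  "mat2 a b c d = a *\<^sub>R axis 1 (axis 1 1) + b *\<^sub>R axis 1 (axis 2 1)
     + c *\<^sub>R axis 2 (axis 1 1) + d *\<^sub>R axis 2 (axis 2 1)"
  by (simp add: vec_eq_iff forall_2 axis_def)

lemma test_function_chain_rule:
  assumes F: "F \<in> test_functions"
    and "(a has_real_derivative a') (at x)" "(b has_real_derivative b') (at x)"
      "(c has_real_derivative c') (at x)" "(d has_real_derivative d') (at x)"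
  defines "A \<equiv> mat2 (a x) (b x) (c x) (d x)"
  shows "((\<lambda>x. F (mat2 (a x) (b x) (c x) (d x))) has_vector_derivative
     of_real a' * partial 1 1 F A + of_real b' * partial 1 2 F A
     + of_real c' * partial 2 1 F A + of_real d' * partial 2 2 F A) (at x)"
proof -
  let ?D = "frechet_derivative F (at A)"
  have FD: "(F has_derivative ?D) (at A)"
    using test_function_differentiable[OF F] by (simp add: frechet_derivative_works)
  then have lin: "linear ?D" by (rule has_derivative_linear)
  have "((\<lambda>x. mat2 (a x) (b x) (c x) (d x)) has_vector_derivative mat2 a' b' c' d') (at x)"
    unfolding mat2_eq_axis using assms(2-5)
    by (auto intro!: derivative_eq_intros simp: has_real_derivative_iff_has_vector_derivative)
  then have "((\<lambda>x. F (mat2 (a x) (b x) (c x) (d x))) has_vector_derivative ?D (mat2 a' b' c' d')) (at x)"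
    using vector_derivative_diff_chain_within[of _ _ x UNIV F ?D] FD unfolding A_def
    by (auto simp: o_def intro: has_derivative_at_withinI)
  moreover have "?D (mat2 a' b' c' d') = a' *\<^sub>R partial 1 1 F A + b' *\<^sub>R partial 1 2 F A
      + c' *\<^sub>R partial 2 1 F A + d' *\<^sub>R partial 2 2 F A"
    by (simp add: mat2_eq_axis linear_add[OF lin] linear_scale[OF lin])
  ultimately show ?thesis by (simp add: scaleR_conv_of_real)
qed

text \<open>
  The Leibniz rule \<open>\<partial>\<^sub>i\<^sub>j (a\<^sub>k\<^sub>l F) = a\<^sub>k\<^sub>l \<partial>\<^sub>i\<^sub>j F + \<delta> F\<close>; it lets integration by parts be applied to \<open>cF\<close>.
\<close>

lemma partial_entry:
  assumes "F \<in> test_functions"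
  shows "partial i j (entry k l F)
           = (\<lambda>A. entry k l (partial i j F) A + (if i = k \<and> j = l then F A else 0))"
proof
  fix A
  let ?e = "\<lambda>A :: real^2^2. complex_of_real (A $ k $ l)"
  have bl: "bounded_linear ?e"
    by (intro bounded_linear_compose[OF bounded_linear_of_real]
        bounded_linear_compose[OF bounded_linear_vec_nth bounded_linear_vec_nth])
  have D: "(?e has_derivative ?e) (at A)"
    using bl by (rule bounded_linear_imp_has_derivative)
  have "?e differentiable (at A)" using D by (auto simp: differentiable_def)
  then have "frechet_derivative (\<lambda>A. ?e A * F A) (at A) v
      = ?e A * frechet_derivative F (at A) v + ?e v * F A" for v
    using frechet_derivative_mult[of ?e A F v] test_function_differentiable[OF assms]
      frechet_derivative_at[OF D, symmetric] by simp
  then show "partial i j (entry k l F) A = entry k l (partial i j F) A + (if i = k \<and> j = l then F A else 0)"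
    by (auto simp: axis_def)
qed


section \<open>Integrals of compactly supported functions with a parameter\<close>

lemma compact_support_integral:
  fixes f :: "'a::euclidean_space \<Rightarrow> complex"
  assumes "continuous_on UNIV f" and "\<And>x. x \<notin> cbox a b \<Longrightarrow> f x = 0"
  shows "integrable lborel f" and "integral\<^sup>L lborel f = integral (cbox a b) f"
proof -
  have "integrable lborel (\<lambda>x. indicator (cbox a b) x *\<^sub>R f x)"
    using assms(1) by (intro borel_integrable_compact) (auto intro: continuous_on_subset)
  moreover have eq: "(\<lambda>x. indicator (cbox a b) x *\<^sub>R f x) = f"
    using assms(2) by (auto simp: indicator_def fun_eq_iff)
  ultimately show int: "integrable lborel f" by simp
  have "(\<lambda>x. if x \<in> cbox a b then f x else 0) = f" using assms(2) by (auto simp: fun_eq_iff)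
  then show "integral\<^sup>L lborel f = integral (cbox a b) f"
    using integral_restrict_UNIV[of "cbox a b" f] integral_lborel[OF int] by simp
qed

text \<open>
  A common support on a neighbourhood of the base point reduces the integral to a fixed box, where
  the classical Leibniz rule applies.
\<close>

lemma leibniz_compact_support:
  fixes \<Phi> \<Phi>' :: "real \<Rightarrow> 'a::euclidean_space \<Rightarrow> complex"
  assumes cont: "continuous_on UNIV (\<lambda>(h, x). \<Phi> h x)" "continuous_on UNIV (\<lambda>(h, x). \<Phi>' h x)"
    and deriv: "\<And>h x. ((\<lambda>h. \<Phi> h x) has_vector_derivative \<Phi>' h x) (at h)"
    and supp: "\<And>h x. \<bar>h\<bar> < 1 \<Longrightarrow> x \<notin> cbox a b \<Longrightarrow> \<Phi> h x = 0"
  shows "((\<lambda>h. LINT x|lborel. \<Phi> h x) has_vector_derivative (LINT x|lborel. \<Phi>' 0 x)) (at 0)"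
proof -
  let ?U = "{-1<..<1::real}"
  have cont1: "continuous_on UNIV (\<Phi> h)" "continuous_on UNIV (\<Phi>' h)" for h
    using continuous_on_compose2[OF cont(1) continuous_on_Pair[OF continuous_on_const[of _ h] continuous_on_id]]
      continuous_on_compose2[OF cont(2) continuous_on_Pair[OF continuous_on_const[of _ h] continuous_on_id]]
    by auto
  have "\<Phi>' 0 x = 0" if "x \<notin> cbox a b" for x
  proof -
    have "((\<lambda>h. \<Phi> h x) has_vector_derivative 0) (at 0)"
      by (rule has_vector_derivative_transform_within_open[OF has_vector_derivative_const[of 0], where S = ?U])
         (use supp that in auto)
    with deriv show ?thesis by (rule vector_derivative_unique_at)
  qed
  then have D: "(LINT x|lborel. \<Phi>' 0 x) = integral (cbox a b) (\<Phi>' 0)"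
    by (intro compact_support_integral cont1)
  have "((\<lambda>h. integral (cbox a b) (\<Phi> h)) has_vector_derivative integral (cbox a b) (\<Phi>' 0)) (at 0 within ?U)"
  proof (rule leibniz_rule_vector_derivative)
    show "((\<lambda>h. \<Phi> h x) has_vector_derivative \<Phi>' h x) (at h within ?U)" for h x
      using deriv by (rule has_vector_derivative_at_within)
    show "\<Phi> h integrable_on cbox a b" for h
      by (intro integrable_continuous continuous_on_subset[OF cont1(1)] subset_UNIV)
    show "continuous_on (?U \<times> cbox a b) (\<lambda>(h, x). \<Phi>' h x)"
      by (rule continuous_on_subset[OF cont(2) subset_UNIV])
  qed auto
  moreover have "at 0 within ?U = at (0 :: real)" by (intro at_within_open) auto
  ultimately have "((\<lambda>h. integral (cbox a b) (\<Phi> h)) has_vector_derivative integral (cbox a b) (\<Phi>' 0)) (at 0)"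
    by (simp only:)
  then have "((\<lambda>h. LINT x|lborel. \<Phi> h x) has_vector_derivative integral (cbox a b) (\<Phi>' 0)) (at 0)"
  proof (rule has_vector_derivative_transform_within_open[where S = ?U])
    fix h assume "h \<in> ?U"
    then have "\<bar>h\<bar> < 1" by auto
    with supp show "integral (cbox a b) (\<Phi> h) = (LINT x|lborel. \<Phi> h x)"
      by (intro compact_support_integral(2)[symmetric] cont1) auto
  qed auto
  then show ?thesis by (simp add: D)
qed

lemma lborel_integral_translate:
  fixes f :: "'a::euclidean_space \<Rightarrow> complex"
  shows "(LINT x|lborel. f (x + c)) = integral\<^sup>L lborel f"
proof (cases "f \<in> borel_measurable lborel")
  case True
  have "integral\<^sup>L lborel f = integral\<^sup>L (distr lborel borel ((+) c)) f"
    by (simp add: lborel_distr_plus)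
  also have "\<dots> = (LINT x|lborel. f (c + x))"
    using True by (intro integral_distr) auto
  finally show ?thesis by (simp add: add.commute)
next
  case False
  have "(\<lambda>x. f (x + c)) \<notin> borel_measurable lborel"
  proof
    assume "(\<lambda>x. f (x + c)) \<in> borel_measurable lborel"
    then have "(\<lambda>x. f (x + c)) \<circ> (\<lambda>x. x - c) \<in> borel_measurable lborel"
      by (intro measurable_comp[of _ _ lborel]) auto
    with False show False by (simp add: o_def)
  qed
  with False show ?thesis by (metis borel_measurable_integrable not_integrable_integral_eq)
qed


section \<open>The integrand of the kernel\<close>

lemma signed_powr_nz:
  "x \<noteq> 0 \<Longrightarrow> signed_powr x \<mu> \<epsilon> = exp (\<mu> * of_real (ln \<bar>x\<bar>)) * (if \<epsilon> = 0 then 1 else of_real (sgn x))"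
  by (simp add: signed_powr_def powr_def Ln_of_real)

lemma signed_powr_shift:
  assumes "x \<noteq> 0"
  shows "of_real x * signed_powr x \<mu> \<epsilon> = signed_powr x (\<mu> + 1) (\<epsilon> + 1)"
proof -
  have "exp (of_real (ln \<bar>x\<bar>)) = complex_of_real \<bar>x\<bar>"
    using assms by (simp only: exp_of_real) simp
  moreover have "complex_of_real x = of_real \<bar>x\<bar> * of_real (sgn x)" "of_real (sgn x) * of_real (sgn x) = (1 :: complex)"
    using assms by (auto simp: sgn_if)
  ultimately show ?thesis
    using assms by (cases \<epsilon>) (auto simp: signed_powr_nz exp_add algebra_simps)
qed

lemma continuous_on_signed_powr:
  assumes "continuous_on X u" "continuous_on X \<mu>" "\<And>x. x \<in> X \<Longrightarrow> u x \<noteq> 0"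
  shows "continuous_on X (\<lambda>x. signed_powr (u x) (\<mu> x) \<epsilon>)"
proof -
  have "continuous_on X (\<lambda>x. exp (\<mu> x * of_real (ln \<bar>u x\<bar>)) * (if \<epsilon> = 0 then 1 else of_real (sgn (u x))))"
    using assms by (cases "\<epsilon> = 0") (auto intro!: continuous_intros)
  then show ?thesis
    using assms(3) by (simp add: signed_powr_nz cong: continuous_on_cong)
qed

text \<open>
  Near \<open>x\<close> the sign of \<open>u\<close> is constant, so that \<open>\<bar>u\<bar>\<close> is \<open>sgn (u x) u\<close>; lowering the exponent by one flips the
  parity because \<open>u = \<bar>u\<bar> sgn u\<close>.
\<close>

lemma has_vector_derivative_signed_powr:
  assumes u: "(u has_real_derivative u') (at x)" and "u x \<noteq> 0"
  shows "((\<lambda>x. signed_powr (u x) \<mu> \<epsilon>) has_vector_derivative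
           of_real u' * (\<mu> * signed_powr (u x) (\<mu> - 1) (\<epsilon> + 1))) (at x)"
proof -
  define \<sigma> where "\<sigma> = (if \<epsilon> = 0 then 1 else complex_of_real (sgn (u x)))"
  have "eventually (\<lambda>y. sgn (u y) = sgn (u x)) (nhds x)"
  proof -
    have "isCont u x" using u by (rule DERIV_isCont)
    then have "eventually (\<lambda>y. u y \<in> (if u x > 0 then {0<..} else {..<0})) (nhds x)"
      using assms(2) by (intro topological_tendstoD[of u "u x"]) (auto simp: isCont_def tendsto_at_iff_tendsto_nhds)
    then show ?thesis by eventually_elim (use assms(2) in \<open>auto split: if_splits\<close>)
  qed
  then obtain S where S: "open S" "x \<in> S" "\<And>y. y \<in> S \<Longrightarrow> sgn (u y) = sgn (u x)"
    by (auto simp: eventually_nhds)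
  have ln: "((\<lambda>y. ln (sgn (u x) * u y)) has_real_derivative u' / u x) (at x)"
    using assms by (auto intro!: derivative_eq_intros simp: sgn_if field_simps)
  have "((\<lambda>y. exp (\<mu> * of_real (ln (sgn (u x) * u y))) * \<sigma>) has_vector_derivative
      (of_real (u' / u x) * \<mu> * exp (\<mu> * of_real (ln (sgn (u x) * u x)))) * \<sigma>) (at x)"
  proof -
    have "((\<lambda>y. of_real (ln (sgn (u x) * u y)) :: complex) has_vector_derivative of_real (u' / u x)) (at x)"
      using ln by (intro has_vector_derivative_of_real) (simp add: has_real_derivative_iff_has_vector_derivative)
    moreover have "((\<lambda>z. exp (\<mu> * z) * \<sigma>) has_field_derivative (\<mu> * exp (\<mu> * z)) * \<sigma>) (at z)" for z
      by (auto intro!: derivative_eq_intros)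
    ultimately show ?thesis
      using field_vector_diff_chain_at[of "\<lambda>y. of_real (ln (sgn (u x) * u y))" _ x "\<lambda>z. exp (\<mu> * z) * \<sigma>"]
      unfolding o_def by (metis (no_types, lifting) mult.assoc)
  qed
  moreover have "exp (\<mu> * of_real (ln (sgn (u x) * u y))) * \<sigma> = signed_powr (u y) \<mu> \<epsilon>" if "y \<in> S" for y
  proof -
    have "u y \<noteq> 0" "\<bar>u y\<bar> = sgn (u x) * u y" using S(3)[OF that] assms(2) by (auto simp: sgn_if split: if_splits)
    then show ?thesis using S(3)[OF that] by (simp add: signed_powr_nz \<sigma>_def)
  qed
  ultimately have "((\<lambda>y. signed_powr (u y) \<mu> \<epsilon>) has_vector_derivative
      of_real (u' / u x) * \<mu> * exp (\<mu> * of_real (ln (sgn (u x) * u x))) * \<sigma>) (at x)"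
    by (rule has_vector_derivative_transform_within_open[OF _ S(1,2)])
  moreover have "exp (\<mu> * of_real (ln (sgn (u x) * u x))) * \<sigma> = of_real (u x) * signed_powr (u x) (\<mu> - 1) (\<epsilon> + 1)"
  proof -
    have "sgn (u x) * u x = \<bar>u x\<bar>" by (auto simp: sgn_if)
    then show ?thesis
      using assms(2) signed_powr_shift[of "u x" "\<mu> - 1" "\<epsilon> + 1"] by (simp add: signed_powr_nz \<sigma>_def add.assoc)
  qed
  ultimately show ?thesis using assms(2) by (simp add: mult.assoc)
qed

definition point :: "real \<Rightarrow> real \<Rightarrow> real \<Rightarrow> real \<Rightarrow> real \<Rightarrow> real^2^2" where
  "point t s u v w = mat2 (u - t * v) (s * u - s * t * v - t * w) v (s * v + w)"

definition integrand ::
    "(real^2^2 \<Rightarrow> complex) \<Rightarrow> real \<Rightarrow> real \<Rightarrow> complex \<Rightarrow> bit \<Rightarrow> complex \<Rightarrow> bit \<Rightarrow> real \<Rightarrow> real \<Rightarrow> real \<Rightarrow> complex" where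
  "integrand F t s \<mu>1 \<epsilon>1 \<mu>2 \<epsilon>2 u v w =
     F (point t s u v w) * signed_powr u (- 3/2 + \<mu>1) \<epsilon>1 * signed_powr w (- 3/2 + \<mu>2) \<epsilon>2"

lemma fourier_kernel_eq:
  "fourier_kernel F t s \<mu>1 \<epsilon>1 \<mu>2 \<epsilon>2 =
     (LINT x|lborel. integrand F t s \<mu>1 \<epsilon>1 \<mu>2 \<epsilon>2 (fst x) (fst (snd x)) (snd (snd x)))"
  by (simp add: fourier_kernel_def integrand_def point_def case_prod_unfold)

lemma det_point: "det (point t s u v w) = u * w"
  by (simp add: point_def algebra_simps)

lemma integrand_singular:
  "F \<in> test_functions \<Longrightarrow> u * w = 0 \<Longrightarrow> integrand F t s \<mu>1 \<epsilon>1 \<mu>2 \<epsilon>2 u v w = 0"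
  using test_function_singular[of F "point t s u v w"] by (simp add: integrand_def det_point)

lemma continuous_on_point:
  assumes "continuous_on X t" "continuous_on X s" "continuous_on X u" "continuous_on X v" "continuous_on X w"
  shows "continuous_on X (\<lambda>x. point (t x) (s x) (u x) (v x) (w x))"
  unfolding point_def mat2_eq_axis using assms by (intro continuous_intros)

text \<open>
  The powers are singular at \<open>uw = 0\<close>, but there the matrix is singular and hence lies outside
  the compact support of the test function, together with a neighbourhood. So the integrand is continuous on two open sets
  that cover everything: \<open>uw \<noteq> 0\<close>, and the set where the matrix avoids the support.
\<close>

lemma continuous_integrand:
  assumes F: "F \<in> test_functions"
    and c: "continuous_on UNIV t" "continuous_on UNIV s" "continuous_on UNIV \<mu>1" "continuous_on UNIV \<mu>2"
      "continuous_on UNIV u" "continuous_on UNIV v" "continuous_on UNIV w"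
  shows "continuous_on UNIV (\<lambda>x. integrand F (t x) (s x) (\<mu>1 x) \<epsilon>1 (\<mu>2 x) \<epsilon>2 (u x) (v x) (w x))"
proof -
  obtain C where C: "compact C" "C \<subseteq> GL2" "\<And>A. A \<notin> C \<Longrightarrow> F A = 0"
    using F by (rule test_functionE) blast
  let ?p = "\<lambda>x. point (t x) (s x) (u x) (v x) (w x)"
  let ?A = "{x. u x * w x \<noteq> 0}" and ?B = "?p -` (- C)"
  note cp = continuous_on_point[OF c(1,2,5-7)]
  have "?A \<union> ?B = UNIV"
  proof -
    have "x \<in> ?B" if "x \<notin> ?A" for x
      using that C(2) det_point[of "t x" "s x" "u x" "v x" "w x"] by (auto simp: GL2_eq)
    then show ?thesis by blast
  qed
  have "continuous_on ?A (\<lambda>x. F (?p x) * signed_powr (u x) (- 3/2 + \<mu>1 x) \<epsilon>1 * signed_powr (w x) (- 3/2 + \<mu>2 x) \<epsilon>2)"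
    using c cp continuous_on_compose2[OF test_function_continuous[OF F] cp]
    by (intro continuous_intros continuous_on_signed_powr) (auto intro: continuous_on_subset)
  moreover have "continuous_on ?B (\<lambda>x. F (?p x) * signed_powr (u x) (- 3/2 + \<mu>1 x) \<epsilon>1 * signed_powr (w x) (- 3/2 + \<mu>2 x) \<epsilon>2)"
    by (rule continuous_on_eq[OF continuous_on_const[of _ 0]]) (use C(3) in auto)
  moreover have "open ?A" using c by (intro open_Collect_neq continuous_intros) 
  moreover have "open ?B" using cp C(1) by (intro open_vimage) (auto intro: compact_imp_closed)
  ultimately have "continuous_on (?A \<union> ?B) (\<lambda>x. F (?p x) * signed_powr (u x) (- 3/2 + \<mu>1 x) \<epsilon>1 * signed_powr (w x) (- 3/2 + \<mu>2 x) \<epsilon>2)"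
    by (intro continuous_on_open_Un)
  then show ?thesis unfolding integrand_def \<open>?A \<union> ?B = UNIV\<close> .
qed

text \<open>
  On the support the entries are bounded, and \<open>v = c\<close>, \<open>u = a + tc\<close>, \<open>w = d - sc\<close>. The bound is uniform
  in bounded \<open>t\<close>, \<open>s\<close> and in the exponents.
\<close>

lemma integrand_support:
  assumes "F \<in> test_functions"
  obtains N where "\<And>t s u v w \<mu>1 \<epsilon>1 \<mu>2 \<epsilon>2. \<bar>t\<bar> \<le> R \<Longrightarrow> \<bar>s\<bar> \<le> R \<Longrightarrow>
    integrand F t s \<mu>1 \<epsilon>1 \<mu>2 \<epsilon>2 u v w \<noteq> 0 \<Longrightarrow> \<bar>u\<bar> \<le> N \<and> \<bar>v\<bar> \<le> N \<and> \<bar>w\<bar> \<le> N"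
proof -
  obtain C where C: "compact C" "C \<subseteq> GL2" "\<And>A. A \<notin> C \<Longrightarrow> F A = 0"
    using assms by (rule test_functionE) blast
  obtain B where B: "\<And>A. A \<in> C \<Longrightarrow> norm A \<le> B"
    using compact_imp_bounded[OF C(1)] by (auto simp: bounded_iff)
  have *: "\<bar>u\<bar> \<le> B + \<bar>R\<bar> * B \<and> \<bar>v\<bar> \<le> B + \<bar>R\<bar> * B \<and> \<bar>w\<bar> \<le> B + \<bar>R\<bar> * B"
    if "\<bar>t\<bar> \<le> R" "\<bar>s\<bar> \<le> R" "integrand F t s \<mu>1 \<epsilon>1 \<mu>2 \<epsilon>2 u v w \<noteq> 0" for t s u v w \<mu>1 \<epsilon>1 \<mu>2 \<epsilon>2
  proof -
    let ?A = "point t s u v w"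
    have "norm ?A \<le> B" using that(3) C(3) B[of ?A] by (auto simp: integrand_def)
    then have e: "\<bar>?A $ i $ j\<bar> \<le> B" for i j
      using component_le_norm_cart[of "?A $ i" j] Finite_Cartesian_Product.norm_nth_le[of ?A i] by simp
    have "0 \<le> B" using e[of 1 1] by linarith
    have 1: "\<bar>v\<bar> \<le> B" "\<bar>u - t * v\<bar> \<le> B" "\<bar>s * v + w\<bar> \<le> B"
      using e[of 2 1] e[of 1 1] e[of 2 2] by (simp_all add: point_def)
    have "\<bar>t * v\<bar> \<le> \<bar>R\<bar> * B" "\<bar>s * v\<bar> \<le> \<bar>R\<bar> * B"
      using that 1 by (auto simp: abs_mult intro!: mult_mono)
    with 1 \<open>0 \<le> B\<close> show ?thesis by auto
  qed
  show thesis by (rule that[OF *])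
qed

lemma mem_cube_iff:
  "x \<in> cbox (- N, - N, - N) (N, N, N) \<longleftrightarrow> \<bar>fst x\<bar> \<le> N \<and> \<bar>fst (snd x)\<bar> \<le> N \<and> \<bar>snd (snd x)\<bar> \<le> (N :: real)"
  by (cases x) (auto simp: cbox_Pair_eq abs_le_iff)

lemma integrable_integrand:
  assumes F: "F \<in> test_functions"
  shows "integrable lborel (\<lambda>x. integrand F t s \<mu>1 \<epsilon>1 \<mu>2 \<epsilon>2 (fst x) (fst (snd x)) (snd (snd x)))"
proof -
  obtain N where N: "\<And>u v w. integrand F t s \<mu>1 \<epsilon>1 \<mu>2 \<epsilon>2 u v w \<noteq> 0 \<Longrightarrow> \<bar>u\<bar> \<le> N \<and> \<bar>v\<bar> \<le> N \<and> \<bar>w\<bar> \<le> N"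
    using integrand_support[OF F, of "max \<bar>t\<bar> \<bar>s\<bar>"] by (metis max.cobounded1 max.cobounded2)
  have "continuous_on UNIV (\<lambda>x. integrand F t s \<mu>1 \<epsilon>1 \<mu>2 \<epsilon>2 (fst x) (fst (snd x)) (snd (snd x)))"
    by (intro continuous_integrand[OF F] continuous_intros)
  then show ?thesis
    by (rule compact_support_integral(1)[where a = "(-N, -N, -N)" and b = "(N, N, N)"])
       (use N in \<open>auto simp: mem_cube_iff\<close>)
qed

lemma fourier_kernel_add:
  assumes "F \<in> test_functions" "G \<in> test_functions"
  shows "fourier_kernel (\<lambda>A. F A + G A) t s \<mu>1 \<epsilon>1 \<mu>2 \<epsilon>2
    = fourier_kernel F t s \<mu>1 \<epsilon>1 \<mu>2 \<epsilon>2 + fourier_kernel G t s \<mu>1 \<epsilon>1 \<mu>2 \<epsilon>2"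
proof -
  have "integrand (\<lambda>A. F A + G A) t s \<mu>1 \<epsilon>1 \<mu>2 \<epsilon>2 u v w
      = integrand F t s \<mu>1 \<epsilon>1 \<mu>2 \<epsilon>2 u v w + integrand G t s \<mu>1 \<epsilon>1 \<mu>2 \<epsilon>2 u v w" for u v w
    by (simp add: integrand_def algebra_simps)
  then show ?thesis
    by (simp add: fourier_kernel_eq integrable_integrand assms)
qed

lemma fourier_kernel_scale:
  "fourier_kernel (\<lambda>A. c * F A) t s \<mu>1 \<epsilon>1 \<mu>2 \<epsilon>2 = c * fourier_kernel F t s \<mu>1 \<epsilon>1 \<mu>2 \<epsilon>2"
  unfolding fourier_kernel_eq
  by (subst integral_mult_right_zero[symmetric]) (simp add: integrand_def mult.assoc)

lemma fourier_kernel_sum: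
  assumes "\<And>x. x \<in> X \<Longrightarrow> G x \<in> test_functions"
  shows "fourier_kernel (\<lambda>A. \<Sum>x\<in>X. G x A) t s \<mu>1 \<epsilon>1 \<mu>2 \<epsilon>2 = (\<Sum>x\<in>X. fourier_kernel (G x) t s \<mu>1 \<epsilon>1 \<mu>2 \<epsilon>2)"
  using assms
proof (induction X rule: infinite_finite_induct)
  case (insert x X)
  then show ?case by (simp add: fourier_kernel_add test_function_sum)
qed (simp_all add: fourier_kernel_eq integrand_def)

lemma continuous_fourier_kernel_\<mu>1:
  assumes F: "F \<in> test_functions"
  shows "continuous_on UNIV (\<lambda>\<mu>1. fourier_kernel F t s \<mu>1 \<epsilon>1 \<mu>2 \<epsilon>2)"
proof -
  obtain N where N: "\<And>u v w \<mu>1. integrand F t s \<mu>1 \<epsilon>1 \<mu>2 \<epsilon>2 u v w \<noteq> 0 \<Longrightarrow> \<bar>u\<bar> \<le> N \<and> \<bar>v\<bar> \<le> N \<and> \<bar>w\<bar> \<le> N"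
    using integrand_support[OF F, of "max \<bar>t\<bar> \<bar>s\<bar>"] by (metis max.cobounded1 max.cobounded2)
  let ?f = "\<lambda>\<mu>1 x. integrand F t s \<mu>1 \<epsilon>1 \<mu>2 \<epsilon>2 (fst x) (fst (snd x)) (snd (snd x))"
  have eq: "fourier_kernel F t s \<mu>1 \<epsilon>1 \<mu>2 \<epsilon>2 = integral (cbox (-N, -N, -N) (N, N, N)) (?f \<mu>1)" for \<mu>1
  proof -
    have "continuous_on UNIV (?f \<mu>1)" by (intro continuous_integrand[OF F] continuous_intros)
    then show ?thesis
      unfolding fourier_kernel_eq
      by (rule compact_support_integral(2)) (use N in \<open>auto simp: mem_cube_iff\<close>)
  qed
  have "continuous_on UNIV (\<lambda>(\<mu>1, x). ?f \<mu>1 x)"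
    unfolding case_prod_unfold by (intro continuous_integrand[OF F] continuous_intros)
  then have "continuous_on UNIV (\<lambda>\<mu>1. integral (cbox (-N, -N, -N) (N, N, N)) (?f \<mu>1))"
    by (intro integral_continuous_on_param) (auto intro: continuous_on_subset)
  then show ?thesis by (simp add: eq)
qed

text \<open>
  The derivative of the integrand when \<open>t\<close>, \<open>s\<close>, \<open>u\<close>, \<open>v\<close>, \<open>w\<close> have velocities \<open>t'\<close>, \<open>s'\<close>, \<open>u'\<close>, \<open>v'\<close>, \<open>w'\<close>:
  the coefficients of the four partial derivatives are the velocities of the matrix entries,
  and the last two summands come from the powers.
\<close>

definition integrand_derivative where
  "integrand_derivative F t' s' u' v' w' t s \<mu>1 \<epsilon>1 \<mu>2 \<epsilon>2 u v w =
     of_real (u' - t' * v - t * v') * integrand (partial 1 1 F) t s \<mu>1 \<epsilon>1 \<mu>2 \<epsilon>2 u v w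
   + of_real (s' * u + s * u' - (s' * t * v + s * t' * v + s * t * v') - (t' * w + t * w'))
       * integrand (partial 1 2 F) t s \<mu>1 \<epsilon>1 \<mu>2 \<epsilon>2 u v w
   + of_real v' * integrand (partial 2 1 F) t s \<mu>1 \<epsilon>1 \<mu>2 \<epsilon>2 u v w
   + of_real (s' * v + s * v' + w') * integrand (partial 2 2 F) t s \<mu>1 \<epsilon>1 \<mu>2 \<epsilon>2 u v w
   + of_real u' * (- 3/2 + \<mu>1) * integrand F t s (\<mu>1 - 1) (\<epsilon>1 + 1) \<mu>2 \<epsilon>2 u v w
   + of_real w' * (- 3/2 + \<mu>2) * integrand F t s \<mu>1 \<epsilon>1 (\<mu>2 - 1) (\<epsilon>2 + 1) u v w"

lemma has_vector_derivative_integrand: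
  assumes F: "F \<in> test_functions"
    and d: "(t has_real_derivative t') (at x)" "(s has_real_derivative s') (at x)"
      "(u has_real_derivative u') (at x)" "(v has_real_derivative v') (at x)"
      "(w has_real_derivative w') (at x)"
  shows "((\<lambda>x. integrand F (t x) (s x) \<mu>1 \<epsilon>1 \<mu>2 \<epsilon>2 (u x) (v x) (w x)) has_vector_derivative
    integrand_derivative F t' s' u' v' w' (t x) (s x) \<mu>1 \<epsilon>1 \<mu>2 \<epsilon>2 (u x) (v x) (w x)) (at x)"
proof -
  let ?p = "\<lambda>x. point (t x) (s x) (u x) (v x) (w x)"
  have Fp: "((\<lambda>x. F (?p x)) has_vector_derivative
     of_real (u' - t' * v x - t x * v') * partial 1 1 F (?p x)
     + of_real (s' * u x + s x * u' - (s' * t x * v x + s x * t' * v x + s x * t x * v') - (t' * w x + t x * w'))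
       * partial 1 2 F (?p x)
     + of_real v' * partial 2 1 F (?p x) + of_real (s' * v x + s x * v' + w') * partial 2 2 F (?p x)) (at x)"
    unfolding point_def
    by (rule test_function_chain_rule[OF F]) (auto intro!: derivative_eq_intros d simp: algebra_simps)
  show ?thesis
  proof (cases "u x * w x = 0")
    case False
    then have nz: "u x \<noteq> 0" "w x \<noteq> 0" by auto
    note D = has_vector_derivative_mult[OF has_vector_derivative_mult[OF Fp
        has_vector_derivative_signed_powr[OF d(3) nz(1), of "- 3/2 + \<mu>1" \<epsilon>1]]
        has_vector_derivative_signed_powr[OF d(5) nz(2), of "- 3/2 + \<mu>2" \<epsilon>2]]
    show ?thesis
      unfolding integrand_def integrand_derivative_def
      by (rule has_vector_derivative_eq_rhs[OF D]) (simp add: algebra_simps)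
  next
    case True
    obtain C where C: "compact C" "C \<subseteq> GL2" "\<And>A. A \<notin> C \<Longrightarrow> F A = 0"
      using F by (rule test_functionE) blast
    have cont: "isCont ?p x"
      unfolding point_def mat2_eq_axis using d[THEN DERIV_isCont] by (intro continuous_intros)
    have lim: "(?p \<longlongrightarrow> ?p x) (nhds x)"
      using cont unfolding isCont_def by (rule iffD1[OF tendsto_at_iff_tendsto_nhds[of ?p x]])
    have "?p x \<in> - C" using True C(2) det_point[of "t x" "s x" "u x" "v x" "w x"] by (auto simp: GL2_eq)
    then have "eventually (\<lambda>y. ?p y \<in> - C) (nhds x)"
      using C(1) by (intro topological_tendstoD[OF lim]) (auto simp: open_Compl compact_imp_closed)
    then obtain S where S: "open S" "x \<in> S" "\<And>y. y \<in> S \<Longrightarrow> ?p y \<notin> C"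
      by (auto simp: eventually_nhds)
    have "((\<lambda>x. integrand F (t x) (s x) \<mu>1 \<epsilon>1 \<mu>2 \<epsilon>2 (u x) (v x) (w x)) has_vector_derivative 0) (at x)"
      by (rule has_vector_derivative_transform_within_open[OF has_vector_derivative_const[of 0] S(1,2)])
         (use S(3) C(3) in \<open>auto simp: integrand_def\<close>)
    moreover have "integrand_derivative F t' s' u' v' w' (t x) (s x) \<mu>1 \<epsilon>1 \<mu>2 \<epsilon>2 (u x) (v x) (w x) = 0"
      using True F by (simp add: integrand_derivative_def integrand_singular test_function_act del: gl2_act.simps)
    ultimately show ?thesis by simp
  qed
qed

text \<open>
  The velocities \<open>u'\<close>, \<open>v'\<close>, \<open>w'\<close> do not occur in the function that is differentiated: translating the integration
  variables leaves the integral unchanged. So the right-hand side is independent of them, which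
  contains integration by parts.
\<close>

lemma fourier_kernel_flow_derivative:
  assumes F: "F \<in> test_functions"
  shows "((\<lambda>h. fourier_kernel F (t + h * t') (s + h * s') \<mu>1 \<epsilon>1 \<mu>2 \<epsilon>2) has_vector_derivative
    (LINT x|lborel. integrand_derivative F t' s' u' v' w' t s \<mu>1 \<epsilon>1 \<mu>2 \<epsilon>2 (fst x) (fst (snd x)) (snd (snd x)))) (at 0)"
proof -
  let ?\<Phi> = "\<lambda>h x. integrand F (t + h * t') (s + h * s') \<mu>1 \<epsilon>1 \<mu>2 \<epsilon>2
    (fst x + h * u') (fst (snd x) + h * v') (snd (snd x) + h * w')"
  let ?\<Phi>' = "\<lambda>h x. integrand_derivative F t' s' u' v' w' (t + h * t') (s + h * s') \<mu>1 \<epsilon>1 \<mu>2 \<epsilon>2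
    (fst x + h * u') (fst (snd x) + h * v') (snd (snd x) + h * w')"
  let ?R = "max (\<bar>t\<bar> + \<bar>t'\<bar>) (\<bar>s\<bar> + \<bar>s'\<bar>)"
  obtain N where N: "\<And>t s u v w. \<bar>t\<bar> \<le> ?R \<Longrightarrow> \<bar>s\<bar> \<le> ?R \<Longrightarrow>
    integrand F t s \<mu>1 \<epsilon>1 \<mu>2 \<epsilon>2 u v w \<noteq> 0 \<Longrightarrow> \<bar>u\<bar> \<le> N \<and> \<bar>v\<bar> \<le> N \<and> \<bar>w\<bar> \<le> N"
    using integrand_support[OF F, of ?R] by metis
  define N' where "N' = N + \<bar>u'\<bar> + \<bar>v'\<bar> + \<bar>w'\<bar>"
  have le': "N + \<bar>u'\<bar> \<le> N'" "N + \<bar>v'\<bar> \<le> N'" "N + \<bar>w'\<bar> \<le> N'"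
    by (simp_all add: N'_def)
  have "((\<lambda>h. LINT x|lborel. ?\<Phi> h x) has_vector_derivative (LINT x|lborel. ?\<Phi>' 0 x)) (at 0)"
  proof (rule leibniz_compact_support)
    show "continuous_on UNIV (\<lambda>(h, x). ?\<Phi> h x)"
      unfolding case_prod_unfold by (intro continuous_integrand[OF F] continuous_intros)
    show "continuous_on UNIV (\<lambda>(h, x). ?\<Phi>' h x)"
      unfolding case_prod_unfold integrand_derivative_def
      by (intro continuous_intros continuous_integrand test_function_act F)
    show "((\<lambda>h. ?\<Phi> h x) has_vector_derivative ?\<Phi>' h x) (at h)" for h x
      by (rule has_vector_derivative_integrand[OF F]) (auto intro!: derivative_eq_intros)
    show "?\<Phi> h x = 0" if h: "\<bar>h\<bar> < 1" and x: "x \<notin> cbox (-N', -N', -N') (N', N', N')" for h x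
    proof (rule ccontr)
      assume nz: "?\<Phi> h x \<noteq> 0"
      have le: "\<bar>h * y\<bar> \<le> \<bar>y\<bar>" for y
        using h by (simp add: abs_mult mult_left_le_one_le)
      have "\<bar>t + h * t'\<bar> \<le> \<bar>t\<bar> + \<bar>t'\<bar>" "\<bar>s + h * s'\<bar> \<le> \<bar>s\<bar> + \<bar>s'\<bar>"
        using le[of t'] le[of s'] by linarith+
      then have "\<bar>t + h * t'\<bar> \<le> ?R" "\<bar>s + h * s'\<bar> \<le> ?R" by (simp_all add: le_max_iff_disj)
      note bounds = N[OF this nz]
      have tri: "\<bar>y\<bar> \<le> N + \<bar>z\<bar>" if "\<bar>y + h * z\<bar> \<le> N" for y z
        using that le[of z] by linarith
      have "\<bar>fst x\<bar> \<le> N'" "\<bar>fst (snd x)\<bar> \<le> N'" "\<bar>snd (snd x)\<bar> \<le> N'"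
        by (rule order_trans[OF tri[OF bounds[THEN conjunct1]] le'(1)],
            rule order_trans[OF tri[OF bounds[THEN conjunct2, THEN conjunct1]] le'(2)],
            rule order_trans[OF tri[OF bounds[THEN conjunct2, THEN conjunct2]] le'(3)])
      with x show False by (simp add: mem_cube_iff)
    qed
  qed
  moreover have "(LINT x|lborel. ?\<Phi> h x) = fourier_kernel F (t + h * t') (s + h * s') \<mu>1 \<epsilon>1 \<mu>2 \<epsilon>2" for h
    using lborel_integral_translate[of "\<lambda>x. integrand F (t + h * t') (s + h * s') \<mu>1 \<epsilon>1 \<mu>2 \<epsilon>2 (fst x) (fst (snd x)) (snd (snd x))" "(h * u', h * v', h * w')"]
    by (simp add: fourier_kernel_eq)
  ultimately show ?thesis by simp
qed

(* The kernel identities below are stated in terms of the generators as such. *)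
declare gl2_act.simps [simp del]


section \<open>The kernel under the elementary operators\<close>

(* Parities stay in the form \<epsilon> + 1, which has to match the exponents \<mu> + 1. *)
declare add_bit_eq_xor [simp del]

lemma bit_add_one_add_one [simp]: "(\<epsilon> :: bit) + 1 + 1 = \<epsilon>"
  by (cases \<epsilon>) auto

lemma has_vector_derivative_translate:
  fixes f :: "real \<Rightarrow> 'a::real_normed_vector"
  assumes "((\<lambda>h. f (x + h)) has_vector_derivative D) (at 0)"
  shows "(f has_vector_derivative D) (at x)"
proof -
  have "((\<lambda>y. y - x) has_vector_derivative 1) (at x)"
    by (auto intro!: derivative_eq_intros)
  from vector_diff_chain_at[OF this, of "\<lambda>h. f (x + h)" D] assms show ?thesis
    by (simp add: o_def)
qed

lemma integrand_entry:
  "integrand (entry 1 1 F) t s \<mu>1 \<epsilon>1 \<mu>2 \<epsilon>2 u v w = (of_real u - of_real t * of_real v) * integrand F t s \<mu>1 \<epsilon>1 \<mu>2 \<epsilon>2 u v w"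
  "integrand (entry 1 2 F) t s \<mu>1 \<epsilon>1 \<mu>2 \<epsilon>2 u v w =
     (of_real s * of_real u - of_real s * of_real t * of_real v - of_real t * of_real w) * integrand F t s \<mu>1 \<epsilon>1 \<mu>2 \<epsilon>2 u v w"
  "integrand (entry 2 1 F) t s \<mu>1 \<epsilon>1 \<mu>2 \<epsilon>2 u v w = of_real v * integrand F t s \<mu>1 \<epsilon>1 \<mu>2 \<epsilon>2 u v w"
  "integrand (entry 2 2 F) t s \<mu>1 \<epsilon>1 \<mu>2 \<epsilon>2 u v w = (of_real s * of_real v + of_real w) * integrand F t s \<mu>1 \<epsilon>1 \<mu>2 \<epsilon>2 u v w"
  by (simp_all add: integrand_def point_def gl2_act.simps)

lemma integrand_shift:
  assumes "F \<in> test_functions"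
  shows "integrand F t s (\<mu>1 + 1) (\<epsilon>1 + 1) \<mu>2 \<epsilon>2 u v w = of_real u * integrand F t s \<mu>1 \<epsilon>1 \<mu>2 \<epsilon>2 u v w"
    and "integrand F t s \<mu>1 \<epsilon>1 (\<mu>2 + 1) (\<epsilon>2 + 1) u v w = of_real w * integrand F t s \<mu>1 \<epsilon>1 \<mu>2 \<epsilon>2 u v w"
proof -
  consider "u * w = 0" | "u \<noteq> 0" "w \<noteq> 0" by auto
  then have "integrand F t s (\<mu>1 + 1) (\<epsilon>1 + 1) \<mu>2 \<epsilon>2 u v w = of_real u * integrand F t s \<mu>1 \<epsilon>1 \<mu>2 \<epsilon>2 u v w
    \<and> integrand F t s \<mu>1 \<epsilon>1 (\<mu>2 + 1) (\<epsilon>2 + 1) u v w = of_real w * integrand F t s \<mu>1 \<epsilon>1 \<mu>2 \<epsilon>2 u v w"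
  proof cases
    case 1
    then show ?thesis by (simp only: integrand_singular[OF assms]) simp
  next
    case 2
    then show ?thesis
      using signed_powr_shift[of u "- 3/2 + \<mu>1" \<epsilon>1] signed_powr_shift[of w "- 3/2 + \<mu>2" \<epsilon>2]
      by (simp add: integrand_def add.assoc[symmetric])
  qed
  then show "integrand F t s (\<mu>1 + 1) (\<epsilon>1 + 1) \<mu>2 \<epsilon>2 u v w = of_real u * integrand F t s \<mu>1 \<epsilon>1 \<mu>2 \<epsilon>2 u v w"
    and "integrand F t s \<mu>1 \<epsilon>1 (\<mu>2 + 1) (\<epsilon>2 + 1) u v w = of_real w * integrand F t s \<mu>1 \<epsilon>1 \<mu>2 \<epsilon>2 u v w"
    by blast+
qed

lemma fourier_kernel_shift1:
  assumes F: "F \<in> test_functions"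
  shows "fourier_kernel F t s (\<mu>1 + 1) (\<epsilon>1 + 1) \<mu>2 \<epsilon>2 =
    fourier_kernel (entry 1 1 F) t s \<mu>1 \<epsilon>1 \<mu>2 \<epsilon>2 + of_real t * fourier_kernel (entry 2 1 F) t s \<mu>1 \<epsilon>1 \<mu>2 \<epsilon>2"
proof -
  have "integrand F t s (\<mu>1 + 1) (\<epsilon>1 + 1) \<mu>2 \<epsilon>2 u v w =
      integrand (entry 1 1 F) t s \<mu>1 \<epsilon>1 \<mu>2 \<epsilon>2 u v w + of_real t * integrand (entry 2 1 F) t s \<mu>1 \<epsilon>1 \<mu>2 \<epsilon>2 u v w" for u v w
    by (simp only: integrand_shift[OF F] integrand_entry) (simp add: algebra_simps)
  then show ?thesis
    by (simp add: fourier_kernel_eq integrable_integrand test_function_act F)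
qed

lemma fourier_kernel_shift2:
  assumes F: "F \<in> test_functions"
  shows "fourier_kernel F t s \<mu>1 \<epsilon>1 (\<mu>2 + 1) (\<epsilon>2 + 1) =
    fourier_kernel (entry 2 2 F) t s \<mu>1 \<epsilon>1 \<mu>2 \<epsilon>2 - of_real s * fourier_kernel (entry 2 1 F) t s \<mu>1 \<epsilon>1 \<mu>2 \<epsilon>2"
proof -
  have "integrand F t s \<mu>1 \<epsilon>1 (\<mu>2 + 1) (\<epsilon>2 + 1) u v w =
      integrand (entry 2 2 F) t s \<mu>1 \<epsilon>1 \<mu>2 \<epsilon>2 u v w - of_real s * integrand (entry 2 1 F) t s \<mu>1 \<epsilon>1 \<mu>2 \<epsilon>2 u v w" for u v w
    by (simp only: integrand_shift[OF F] integrand_entry) (simp add: algebra_simps)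
  then show ?thesis
    by (simp add: fourier_kernel_eq integrable_integrand test_function_act F)
qed

text \<open>
  By \<open>b = sa - td + stc\<close>.
\<close>

lemma fourier_kernel_entry12:
  assumes F: "F \<in> test_functions"
  shows "fourier_kernel (entry 1 2 F) t s \<mu>1 \<epsilon>1 \<mu>2 \<epsilon>2 =
    of_real s * fourier_kernel (entry 1 1 F) t s \<mu>1 \<epsilon>1 \<mu>2 \<epsilon>2
    - of_real t * fourier_kernel (entry 2 2 F) t s \<mu>1 \<epsilon>1 \<mu>2 \<epsilon>2
    + of_real s * (of_real t * fourier_kernel (entry 2 1 F) t s \<mu>1 \<epsilon>1 \<mu>2 \<epsilon>2)"
proof -
  have "integrand (entry 1 2 F) t s \<mu>1 \<epsilon>1 \<mu>2 \<epsilon>2 u v w =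
      of_real s * integrand (entry 1 1 F) t s \<mu>1 \<epsilon>1 \<mu>2 \<epsilon>2 u v w - of_real t * integrand (entry 2 2 F) t s \<mu>1 \<epsilon>1 \<mu>2 \<epsilon>2 u v w
      + of_real s * (of_real t * integrand (entry 2 1 F) t s \<mu>1 \<epsilon>1 \<mu>2 \<epsilon>2 u v w)" for u v w
    by (simp add: integrand_entry algebra_simps)
  then show ?thesis
    by (simp add: fourier_kernel_eq integrable_integrand test_function_act F)
qed

lemma fourier_kernel_inv_det:
  assumes F: "F \<in> test_functions"
  shows "fourier_kernel (gl2_act Inv_det F) t s \<mu>1 \<epsilon>1 \<mu>2 \<epsilon>2 =
    fourier_kernel F t s (\<mu>1 - 1) (\<epsilon>1 + 1) (\<mu>2 - 1) (\<epsilon>2 + 1)"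
proof -
  have "integrand (gl2_act Inv_det F) t s \<mu>1 \<epsilon>1 \<mu>2 \<epsilon>2 u v w =
      integrand F t s (\<mu>1 - 1) (\<epsilon>1 + 1) (\<mu>2 - 1) (\<epsilon>2 + 1) u v w" for u v w
  proof (cases "u * w = 0")
    case True
    then show ?thesis by (simp only: integrand_singular F test_function_act)
  next
    case False
    have "integrand F t s \<mu>1 \<epsilon>1 \<mu>2 \<epsilon>2 u v w =
        of_real u * (of_real w * integrand F t s (\<mu>1 - 1) (\<epsilon>1 + 1) (\<mu>2 - 1) (\<epsilon>2 + 1) u v w)"
      using integrand_shift(1)[OF F, of t s "\<mu>1 - 1" "\<epsilon>1 + 1" \<mu>2 \<epsilon>2 u v w]
        integrand_shift(2)[OF F, of t s "\<mu>1 - 1" "\<epsilon>1 + 1" "\<mu>2 - 1" "\<epsilon>2 + 1" u v w] by simp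
    moreover have "integrand (gl2_act Inv_det F) t s \<mu>1 \<epsilon>1 \<mu>2 \<epsilon>2 u v w =
        of_real (inverse (u * w)) * integrand F t s \<mu>1 \<epsilon>1 \<mu>2 \<epsilon>2 u v w"
      by (simp add: integrand_def gl2_act.simps det_point)
    ultimately show ?thesis using False by (simp add: field_simps)
  qed
  then show ?thesis by (simp add: fourier_kernel_eq)
qed

lemma fourier_kernel_dt:
  assumes F: "F \<in> test_functions"
  shows "((\<lambda>t. fourier_kernel F t s \<mu>1 \<epsilon>1 \<mu>2 \<epsilon>2) has_vector_derivative
    - (fourier_kernel (entry 2 1 (partial 1 1 F)) t s \<mu>1 \<epsilon>1 \<mu>2 \<epsilon>2
      + fourier_kernel (entry 2 2 (partial 1 2 F)) t s \<mu>1 \<epsilon>1 \<mu>2 \<epsilon>2)) (at t)"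
proof -
  have "integrand_derivative F 1 0 0 0 0 t s \<mu>1 \<epsilon>1 \<mu>2 \<epsilon>2 u v w =
      - (integrand (entry 2 1 (partial 1 1 F)) t s \<mu>1 \<epsilon>1 \<mu>2 \<epsilon>2 u v w
      + integrand (entry 2 2 (partial 1 2 F)) t s \<mu>1 \<epsilon>1 \<mu>2 \<epsilon>2 u v w)" for u v w
    by (simp add: integrand_derivative_def integrand_entry algebra_simps)
  then have "((\<lambda>h. fourier_kernel F (t + h) s \<mu>1 \<epsilon>1 \<mu>2 \<epsilon>2) has_vector_derivative
    - (fourier_kernel (entry 2 1 (partial 1 1 F)) t s \<mu>1 \<epsilon>1 \<mu>2 \<epsilon>2
      + fourier_kernel (entry 2 2 (partial 1 2 F)) t s \<mu>1 \<epsilon>1 \<mu>2 \<epsilon>2)) (at 0)"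
    using fourier_kernel_flow_derivative[OF F, of t 1 s 0 \<mu>1 \<epsilon>1 \<mu>2 \<epsilon>2 0 0 0]
    by (simp add: fourier_kernel_eq integrable_integrand test_function_act F)
  then show ?thesis by (rule has_vector_derivative_translate)
qed

lemma fourier_kernel_ds:
  assumes F: "F \<in> test_functions"
  shows "((\<lambda>s. fourier_kernel F t s \<mu>1 \<epsilon>1 \<mu>2 \<epsilon>2) has_vector_derivative
    fourier_kernel (entry 1 1 (partial 1 2 F)) t s \<mu>1 \<epsilon>1 \<mu>2 \<epsilon>2
      + fourier_kernel (entry 2 1 (partial 2 2 F)) t s \<mu>1 \<epsilon>1 \<mu>2 \<epsilon>2) (at s)"
proof -
  have "integrand_derivative F 0 1 0 0 0 t s \<mu>1 \<epsilon>1 \<mu>2 \<epsilon>2 u v w =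
      integrand (entry 1 1 (partial 1 2 F)) t s \<mu>1 \<epsilon>1 \<mu>2 \<epsilon>2 u v w
      + integrand (entry 2 1 (partial 2 2 F)) t s \<mu>1 \<epsilon>1 \<mu>2 \<epsilon>2 u v w" for u v w
    by (simp add: integrand_derivative_def integrand_entry algebra_simps)
  then have "((\<lambda>h. fourier_kernel F t (s + h) \<mu>1 \<epsilon>1 \<mu>2 \<epsilon>2) has_vector_derivative
    fourier_kernel (entry 1 1 (partial 1 2 F)) t s \<mu>1 \<epsilon>1 \<mu>2 \<epsilon>2
      + fourier_kernel (entry 2 1 (partial 2 2 F)) t s \<mu>1 \<epsilon>1 \<mu>2 \<epsilon>2) (at 0)"
    using fourier_kernel_flow_derivative[OF F, of t 0 s 1 \<mu>1 \<epsilon>1 \<mu>2 \<epsilon>2 0 0 0]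
    by (simp add: fourier_kernel_eq integrable_integrand test_function_act F)
  then show ?thesis by (rule has_vector_derivative_translate)
qed

text \<open>
  The three cases are translations in \<open>u\<close>, \<open>v\<close>, \<open>w\<close>; with \<open>t\<close> and \<open>s\<close> fixed the kernel does not move, so the
  integrated derivative is zero.
\<close>

lemma fourier_kernel_by_parts:
  assumes F: "F \<in> test_functions"
  shows "fourier_kernel (partial 1 1 F) t s \<mu>1 \<epsilon>1 \<mu>2 \<epsilon>2 + of_real s * fourier_kernel (partial 1 2 F) t s \<mu>1 \<epsilon>1 \<mu>2 \<epsilon>2
      = - ((- 3/2 + \<mu>1) * fourier_kernel F t s (\<mu>1 - 1) (\<epsilon>1 + 1) \<mu>2 \<epsilon>2)" (is ?u)
    and "fourier_kernel (partial 2 1 F) t s \<mu>1 \<epsilon>1 \<mu>2 \<epsilon>2 + of_real s * fourier_kernel (partial 2 2 F) t s \<mu>1 \<epsilon>1 \<mu>2 \<epsilon>2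
      = of_real t * (fourier_kernel (partial 1 1 F) t s \<mu>1 \<epsilon>1 \<mu>2 \<epsilon>2 + of_real s * fourier_kernel (partial 1 2 F) t s \<mu>1 \<epsilon>1 \<mu>2 \<epsilon>2)" (is ?v)
    and "fourier_kernel (partial 2 2 F) t s \<mu>1 \<epsilon>1 \<mu>2 \<epsilon>2 - of_real t * fourier_kernel (partial 1 2 F) t s \<mu>1 \<epsilon>1 \<mu>2 \<epsilon>2
      = - ((- 3/2 + \<mu>2) * fourier_kernel F t s \<mu>1 \<epsilon>1 (\<mu>2 - 1) (\<epsilon>2 + 1))" (is ?w)
proof -
  have zero: "(LINT x|lborel. integrand_derivative F 0 0 u' v' w' t s \<mu>1 \<epsilon>1 \<mu>2 \<epsilon>2 (fst x) (fst (snd x)) (snd (snd x))) = 0" for u' v' w'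
    by (rule vector_derivative_unique_at[OF _ has_vector_derivative_const])
       (use fourier_kernel_flow_derivative[OF F, of t 0 s 0 \<mu>1 \<epsilon>1 \<mu>2 \<epsilon>2 u' v' w'] in simp)
  note [simp] = integrable_integrand test_function_act F
  have "(LINT x|lborel. integrand_derivative F 0 0 1 0 0 t s \<mu>1 \<epsilon>1 \<mu>2 \<epsilon>2 (fst x) (fst (snd x)) (snd (snd x))) =
      fourier_kernel (partial 1 1 F) t s \<mu>1 \<epsilon>1 \<mu>2 \<epsilon>2 + of_real s * fourier_kernel (partial 1 2 F) t s \<mu>1 \<epsilon>1 \<mu>2 \<epsilon>2
      + (- 3/2 + \<mu>1) * fourier_kernel F t s (\<mu>1 - 1) (\<epsilon>1 + 1) \<mu>2 \<epsilon>2"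
    by (simp add: integrand_derivative_def fourier_kernel_eq)
  with zero show ?u by (simp add: eq_neg_iff_add_eq_0)
  have "(LINT x|lborel. integrand_derivative F 0 0 0 1 0 t s \<mu>1 \<epsilon>1 \<mu>2 \<epsilon>2 (fst x) (fst (snd x)) (snd (snd x))) =
      - (of_real t * fourier_kernel (partial 1 1 F) t s \<mu>1 \<epsilon>1 \<mu>2 \<epsilon>2) - of_real s * of_real t * fourier_kernel (partial 1 2 F) t s \<mu>1 \<epsilon>1 \<mu>2 \<epsilon>2
      + fourier_kernel (partial 2 1 F) t s \<mu>1 \<epsilon>1 \<mu>2 \<epsilon>2 + of_real s * fourier_kernel (partial 2 2 F) t s \<mu>1 \<epsilon>1 \<mu>2 \<epsilon>2"
    by (simp add: integrand_derivative_def fourier_kernel_eq)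
  with zero show ?v by (simp add: algebra_simps)
  have "(LINT x|lborel. integrand_derivative F 0 0 0 0 1 t s \<mu>1 \<epsilon>1 \<mu>2 \<epsilon>2 (fst x) (fst (snd x)) (snd (snd x))) =
      - (of_real t * fourier_kernel (partial 1 2 F) t s \<mu>1 \<epsilon>1 \<mu>2 \<epsilon>2) + fourier_kernel (partial 2 2 F) t s \<mu>1 \<epsilon>1 \<mu>2 \<epsilon>2
      + (- 3/2 + \<mu>2) * fourier_kernel F t s \<mu>1 \<epsilon>1 (\<mu>2 - 1) (\<epsilon>2 + 1)"
    by (simp add: integrand_derivative_def fourier_kernel_eq)
  with zero show ?w by (simp add: eq_neg_iff_add_eq_0)
qed

text \<open>
  The integrated form of \<open>u \<partial>\<^sub>tG + w \<partial>\<^sub>sG = v (w \<partial>\<^sub>wG - u \<partial>\<^sub>uG)\<close>. The derivatives of the shifted kernels are kernels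
  of \<open>cF\<^sub>a\<close>, \<open>dF\<^sub>b\<close>, \<open>aF\<^sub>b\<close>, \<open>cF\<^sub>d\<close>; integration by parts for \<open>cF\<close> in \<open>u\<close> and in \<open>w\<close> produces the factor \<open>\<mu>\<^sub>1 - \<mu>\<^sub>2\<close> as
  the difference of the two exponents, and the remaining terms in \<open>F\<^sub>b\<close> cancel because both describe
  the kernel of \<open>F\<^sub>b\<close> with both shifts applied.
\<close>

lemma fourier_kernel_entry21:
  assumes F: "F \<in> test_functions"
  shows "(\<mu>1 - \<mu>2) * fourier_kernel (entry 2 1 F) t s \<mu>1 \<epsilon>1 \<mu>2 \<epsilon>2 =
    vector_derivative (\<lambda>t. fourier_kernel F t s (\<mu>1 + 1) (\<epsilon>1 + 1) \<mu>2 \<epsilon>2) (at t)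
    + vector_derivative (\<lambda>s. fourier_kernel F t s \<mu>1 \<epsilon>1 (\<mu>2 + 1) (\<epsilon>2 + 1)) (at s)"
proof -
  note [simp] = test_function_act F
  let ?B = "partial 1 2 F"
  define k x1 x2 x3 x4 y z where defs:
    "k = fourier_kernel (entry 2 1 F) t s \<mu>1 \<epsilon>1 \<mu>2 \<epsilon>2"
    "x1 = fourier_kernel (entry 2 1 (partial 1 1 F)) t s (\<mu>1 + 1) (\<epsilon>1 + 1) \<mu>2 \<epsilon>2"
    "x2 = fourier_kernel (entry 2 2 ?B) t s (\<mu>1 + 1) (\<epsilon>1 + 1) \<mu>2 \<epsilon>2"
    "x3 = fourier_kernel (entry 1 1 ?B) t s \<mu>1 \<epsilon>1 (\<mu>2 + 1) (\<epsilon>2 + 1)"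
    "x4 = fourier_kernel (entry 2 1 (partial 2 2 F)) t s \<mu>1 \<epsilon>1 (\<mu>2 + 1) (\<epsilon>2 + 1)"
    "y = fourier_kernel (entry 2 1 ?B) t s (\<mu>1 + 1) (\<epsilon>1 + 1) \<mu>2 \<epsilon>2"
    "z = fourier_kernel (entry 2 1 ?B) t s \<mu>1 \<epsilon>1 (\<mu>2 + 1) (\<epsilon>2 + 1)"
  have 1: "vector_derivative (\<lambda>t. fourier_kernel F t s (\<mu>1 + 1) (\<epsilon>1 + 1) \<mu>2 \<epsilon>2) (at t) = - (x1 + x2)"
    unfolding defs by (rule vector_derivative_at[OF fourier_kernel_dt[OF F]])
  have 2: "vector_derivative (\<lambda>s. fourier_kernel F t s \<mu>1 \<epsilon>1 (\<mu>2 + 1) (\<epsilon>2 + 1)) (at s) = x3 + x4"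
    unfolding defs by (rule vector_derivative_at[OF fourier_kernel_ds[OF F]])
  have 3: "x1 + of_real s * y = - ((- 3/2 + (\<mu>1 + 1)) * k)"
    using fourier_kernel_by_parts(1)[of "entry 2 1 F" t s "\<mu>1 + 1" "\<epsilon>1 + 1" \<mu>2 \<epsilon>2]
    by (simp add: partial_entry defs)
  have 4: "x4 - of_real t * z = - ((- 3/2 + (\<mu>2 + 1)) * k)"
    using fourier_kernel_by_parts(3)[of "entry 2 1 F" t s \<mu>1 \<epsilon>1 "\<mu>2 + 1" "\<epsilon>2 + 1"]
    by (simp add: partial_entry defs)
  have 5: "x2 - of_real s * y = x3 + of_real t * z"
    using fourier_kernel_shift1[of ?B t s \<mu>1 \<epsilon>1 "\<mu>2 + 1" "\<epsilon>2 + 1"]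
      fourier_kernel_shift2[of ?B t s "\<mu>1 + 1" "\<epsilon>1 + 1" \<mu>2 \<epsilon>2]
    by (simp add: defs)
  have "(\<mu>1 - \<mu>2) * k = ((- 3/2 + (\<mu>1 + 1)) * k) - ((- 3/2 + (\<mu>2 + 1)) * k)"
    by (simp add: algebra_simps)
  also have "\<dots> = - (x1 + x2) + (x3 + x4)"
    using 3 4 5 by algebra
  finally have "(\<mu>1 - \<mu>2) * k = - (x1 + x2) + (x3 + x4)" .
  then show ?thesis unfolding 1 2 by (simp add: defs)
qed

text \<open>
  Multiplying the integrand by \<open>u\<^sup>-\<^sup>1\<close> in \<open>\<partial>\<^sub>sG = uF\<^sub>b + v \<partial>\<^sub>wG\<close> isolates \<open>F\<^sub>b\<close>, and the term \<open>v \<partial>\<^sub>wG\<close> is integrated by parts.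
\<close>

lemma fourier_kernel_partial12:
  assumes F: "F \<in> test_functions"
  shows "fourier_kernel (partial 1 2 F) t s \<mu>1 \<epsilon>1 \<mu>2 \<epsilon>2 =
    vector_derivative (\<lambda>s. fourier_kernel F t s (\<mu>1 - 1) (\<epsilon>1 + 1) \<mu>2 \<epsilon>2) (at s)
    + (- 3/2 + \<mu>2) * fourier_kernel (entry 2 1 F) t s (\<mu>1 - 1) (\<epsilon>1 + 1) (\<mu>2 - 1) (\<epsilon>2 + 1)"
proof -
  note [simp] = test_function_act F
  let ?B = "partial 1 2 F"
  have 1: "vector_derivative (\<lambda>s. fourier_kernel F t s (\<mu>1 - 1) (\<epsilon>1 + 1) \<mu>2 \<epsilon>2) (at s) =
      fourier_kernel (entry 1 1 ?B) t s (\<mu>1 - 1) (\<epsilon>1 + 1) \<mu>2 \<epsilon>2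
      + fourier_kernel (entry 2 1 (partial 2 2 F)) t s (\<mu>1 - 1) (\<epsilon>1 + 1) \<mu>2 \<epsilon>2"
    by (rule vector_derivative_at[OF fourier_kernel_ds[OF F]])
  have 2: "fourier_kernel (entry 2 1 (partial 2 2 F)) t s (\<mu>1 - 1) (\<epsilon>1 + 1) \<mu>2 \<epsilon>2
      - of_real t * fourier_kernel (entry 2 1 ?B) t s (\<mu>1 - 1) (\<epsilon>1 + 1) \<mu>2 \<epsilon>2
      = - ((- 3/2 + \<mu>2) * fourier_kernel (entry 2 1 F) t s (\<mu>1 - 1) (\<epsilon>1 + 1) (\<mu>2 - 1) (\<epsilon>2 + 1))"
    using fourier_kernel_by_parts(3)[of "entry 2 1 F" t s "\<mu>1 - 1" "\<epsilon>1 + 1" \<mu>2 \<epsilon>2]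
    by (simp add: partial_entry)
  have 3: "fourier_kernel ?B t s \<mu>1 \<epsilon>1 \<mu>2 \<epsilon>2 = fourier_kernel (entry 1 1 ?B) t s (\<mu>1 - 1) (\<epsilon>1 + 1) \<mu>2 \<epsilon>2
      + of_real t * fourier_kernel (entry 2 1 ?B) t s (\<mu>1 - 1) (\<epsilon>1 + 1) \<mu>2 \<epsilon>2"
    using fourier_kernel_shift1[of ?B t s "\<mu>1 - 1" "\<epsilon>1 + 1" \<mu>2 \<epsilon>2] by simp
  show ?thesis unfolding 1 3 using 2 by algebra
qed


section \<open>Rational functions regular off integer lines\<close>

definition regular_at :: "ratfun \<Rightarrow> complex \<Rightarrow> complex \<Rightarrow> bool" where
  "regular_at r \<mu>1 \<mu>2 \<longleftrightarrow> (\<mu>1, \<mu>2) \<notin> polar_set r"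

lemma poly2_simps [simp]:
  "poly2 0 \<mu>1 \<mu>2 = 0" "poly2 1 \<mu>1 \<mu>2 = 1"
  "poly2 (p + q) \<mu>1 \<mu>2 = poly2 p \<mu>1 \<mu>2 + poly2 q \<mu>1 \<mu>2"
  "poly2 (p * q) \<mu>1 \<mu>2 = poly2 p \<mu>1 \<mu>2 * poly2 q \<mu>1 \<mu>2"
  "poly2 (smult c p) \<mu>1 \<mu>2 = poly c \<mu>2 * poly2 p \<mu>1 \<mu>2"
  "poly2 (pCons c p) \<mu>1 \<mu>2 = poly c \<mu>2 + \<mu>1 * poly2 p \<mu>1 \<mu>2"
  by (simp_all add: poly2_def)

lemma regular_at_0: "regular_at 0 \<mu>1 \<mu>2" and ratfun_eval_0: "ratfun_eval 0 \<mu>1 \<mu>2 = 0"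
  by (simp_all add: regular_at_def polar_set_def ratfun_eval_def)

text \<open>
  Evaluation is defined through the fraction in lowest terms; its denominator divides every other
  denominator of the same fraction, so any representation with non-vanishing denominator may be used.
\<close>

lemma ratfun_eval_Fract:
  assumes "poly2 q \<mu>1 \<mu>2 \<noteq> 0"
  shows "regular_at (Fract p q) \<mu>1 \<mu>2"
    and "ratfun_eval (Fract p q) \<mu>1 \<mu>2 = poly2 p \<mu>1 \<mu>2 / poly2 q \<mu>1 \<mu>2"
proof -
  obtain a b where ab: "quot_of_fract (Fract p q) = (a, b)" by force
  have "q \<noteq> 0" using assms by auto
  have "b \<noteq> 0" using snd_quot_of_fract_nonzero[of "Fract p q"] ab by simp
  have "Fract a b = Fract p q" using Fract_quot_of_fract[of "Fract p q"] ab by simp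
  then have eq: "a * q = p * b" using \<open>q \<noteq> 0\<close> \<open>b \<noteq> 0\<close> by (simp add: eq_fract)
  have "coprime a b" using coprime_quot_of_fract[of "Fract p q"] ab by simp
  then have "b dvd q" using eq by (metis coprime_commute coprime_dvd_mult_right_iff dvd_triv_right)
  then have "poly2 b \<mu>1 \<mu>2 \<noteq> 0" using assms by (auto elim!: dvdE)
  then show "regular_at (Fract p q) \<mu>1 \<mu>2"
    and "ratfun_eval (Fract p q) \<mu>1 \<mu>2 = poly2 p \<mu>1 \<mu>2 / poly2 q \<mu>1 \<mu>2"
    using arg_cong[OF eq, of "\<lambda>p. poly2 p \<mu>1 \<mu>2"] assms
    by (simp_all add: regular_at_def polar_set_def ratfun_eval_def ab frac_eq_eq)
qed

lemma ratfun_eval_add: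
  assumes "regular_at r \<mu>1 \<mu>2" "regular_at r' \<mu>1 \<mu>2"
  shows "regular_at (r + r') \<mu>1 \<mu>2"
    and "ratfun_eval (r + r') \<mu>1 \<mu>2 = ratfun_eval r \<mu>1 \<mu>2 + ratfun_eval r' \<mu>1 \<mu>2"
proof -
  obtain a b where ab: "quot_of_fract r = (a, b)" by force
  obtain c d where cd: "quot_of_fract r' = (c, d)" by force
  have nz: "poly2 b \<mu>1 \<mu>2 \<noteq> 0" "poly2 d \<mu>1 \<mu>2 \<noteq> 0"
    using assms by (simp_all add: regular_at_def polar_set_def ab cd)
  then have "b \<noteq> 0" "d \<noteq> 0" by auto
  moreover have "r = Fract a b" "r' = Fract c d"
    using Fract_quot_of_fract[of r] Fract_quot_of_fract[of r'] ab cd by simp_all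
  ultimately have "r + r' = Fract (a * d + c * b) (b * d)" by simp
  then show "regular_at (r + r') \<mu>1 \<mu>2"
    and "ratfun_eval (r + r') \<mu>1 \<mu>2 = ratfun_eval r \<mu>1 \<mu>2 + ratfun_eval r' \<mu>1 \<mu>2"
    using ratfun_eval_Fract[of "b * d" \<mu>1 \<mu>2 "a * d + c * b"] nz
    by (simp_all add: ratfun_eval_def ab cd add_frac_eq)
qed

lemma continuous_poly2: "continuous_on UNIV (\<lambda>\<mu>1. poly2 p \<mu>1 \<mu>2)"
  by (induction p) (auto intro!: continuous_intros)

lemma isCont_ratfun_eval:
  assumes "regular_at r \<mu>1 \<mu>2"
  shows "isCont (\<lambda>z. ratfun_eval r z \<mu>2) \<mu>1"
  unfolding ratfun_eval_def
  using assms continuous_poly2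
  by (intro isCont_divide) (auto simp: regular_at_def polar_set_def continuous_on_eq_continuous_at)

definition off_lines :: "int set \<Rightarrow> complex \<Rightarrow> complex \<Rightarrow> bool" where
  "off_lines M \<mu>1 \<mu>2 \<longleftrightarrow> \<mu>1 - \<mu>2 \<notin> of_int ` M"

text \<open>
  Coefficients are handled as functions off the lines \<open>\<mu>\<^sub>1 - \<mu>\<^sub>2 = m\<close>, \<open>m \<in> M\<close>, which makes products and shifts of the
  arguments immediate; a rational function in lowest terms is chosen only at the very end.
\<close>

definition rational_off_lines :: "int set \<Rightarrow> (complex \<Rightarrow> complex \<Rightarrow> complex) \<Rightarrow> bool" where
  "rational_off_lines M c \<longleftrightarrow> (\<exists>p q. \<forall>\<mu>1 \<mu>2. off_lines M \<mu>1 \<mu>2 \<longrightarrow>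
     poly2 q \<mu>1 \<mu>2 \<noteq> 0 \<and> c \<mu>1 \<mu>2 = poly2 p \<mu>1 \<mu>2 / poly2 q \<mu>1 \<mu>2)"

lemma off_lines_mono: "off_lines M' \<mu>1 \<mu>2 \<Longrightarrow> M \<subseteq> M' \<Longrightarrow> off_lines M \<mu>1 \<mu>2"
  by (auto simp: off_lines_def)

lemma rational_off_lines_mono:
  "rational_off_lines M c \<Longrightarrow> M \<subseteq> M' \<Longrightarrow> rational_off_lines M' c"
  unfolding rational_off_lines_def by (meson off_lines_mono)

lemma rational_off_lines_poly: "rational_off_lines M (poly2 p)"
  unfolding rational_off_lines_def by (rule exI[of _ p], rule exI[of _ 1]) simp

lemma rational_off_lines_mult:
  assumes "rational_off_lines M c" "rational_off_lines M c'"
  shows "rational_off_lines M (\<lambda>\<mu>1 \<mu>2. c \<mu>1 \<mu>2 * c' \<mu>1 \<mu>2)"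
proof -
  obtain p q p' q' where
    "\<And>\<mu>1 \<mu>2. off_lines M \<mu>1 \<mu>2 \<Longrightarrow> poly2 q \<mu>1 \<mu>2 \<noteq> 0 \<and> c \<mu>1 \<mu>2 = poly2 p \<mu>1 \<mu>2 / poly2 q \<mu>1 \<mu>2"
    "\<And>\<mu>1 \<mu>2. off_lines M \<mu>1 \<mu>2 \<Longrightarrow> poly2 q' \<mu>1 \<mu>2 \<noteq> 0 \<and> c' \<mu>1 \<mu>2 = poly2 p' \<mu>1 \<mu>2 / poly2 q' \<mu>1 \<mu>2"
    using assms unfolding rational_off_lines_def by blast
  then show ?thesis
    unfolding rational_off_lines_def by (intro exI[of _ "p * p'"] exI[of _ "q * q'"]) simp
qed

lemma rational_off_lines_inverse_diff: "rational_off_lines {0} (\<lambda>\<mu>1 \<mu>2. 1 / (\<mu>1 - \<mu>2))"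
  unfolding rational_off_lines_def
  by (rule exI[of _ 1], rule exI[of _ "[:[:0, -1:], 1:]"]) (simp add: off_lines_def)

lemma poly2_shift: "\<exists>p'. \<forall>\<mu>1 \<mu>2. poly2 p' \<mu>1 \<mu>2 = poly2 p (\<mu>1 + a) (\<mu>2 + b)"
proof (induction p)
  case 0
  then show ?case by (intro exI[of _ 0]) simp
next
  case (pCons c p)
  then obtain p' where "\<And>\<mu>1 \<mu>2. poly2 p' \<mu>1 \<mu>2 = poly2 p (\<mu>1 + a) (\<mu>2 + b)" by blast
  then show ?case
    by (intro exI[of _ "[:pcompose c [:b, 1:]:] + [:[:a:], 1:] * p'"])
       (simp add: poly_pcompose algebra_simps)
qed

text \<open>
  The line \<open>\<mu>\<^sub>1 - \<mu>\<^sub>2 = m\<close> is pulled back by the shift to the line \<open>\<mu>\<^sub>1 - \<mu>\<^sub>2 = m - k + l\<close>.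
\<close>

lemma rational_off_lines_shift:
  assumes "rational_off_lines M c"
  shows "rational_off_lines ((\<lambda>m. m - k + l) ` M) (\<lambda>\<mu>1 \<mu>2. c (\<mu>1 + of_int k) (\<mu>2 + of_int l))"
proof -
  obtain p q where pq: "\<And>\<mu>1 \<mu>2. off_lines M \<mu>1 \<mu>2 \<Longrightarrow> poly2 q \<mu>1 \<mu>2 \<noteq> 0 \<and> c \<mu>1 \<mu>2 = poly2 p \<mu>1 \<mu>2 / poly2 q \<mu>1 \<mu>2"
    using assms unfolding rational_off_lines_def by blast
  obtain p' where p': "\<And>\<mu>1 \<mu>2. poly2 p' \<mu>1 \<mu>2 = poly2 p (\<mu>1 + of_int k) (\<mu>2 + of_int l)"
    using poly2_shift by blast
  obtain q' where q': "\<And>\<mu>1 \<mu>2. poly2 q' \<mu>1 \<mu>2 = poly2 q (\<mu>1 + of_int k) (\<mu>2 + of_int l)"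
    using poly2_shift by blast
  have "off_lines M (\<mu>1 + of_int k) (\<mu>2 + of_int l)" if "off_lines ((\<lambda>m. m - k + l) ` M) \<mu>1 \<mu>2" for \<mu>1 \<mu>2
    using that by (force simp: off_lines_def algebra_simps)
  then show ?thesis
    unfolding rational_off_lines_def using pq by (intro exI[of _ p'] exI[of _ q']) (simp add: p' q')
qed

lemma rational_off_lines_ratfun:
  assumes "rational_off_lines M c"
  obtains r where "\<And>\<mu>1 \<mu>2. off_lines M \<mu>1 \<mu>2 \<Longrightarrow> regular_at r \<mu>1 \<mu>2"
    and "\<And>\<mu>1 \<mu>2. off_lines M \<mu>1 \<mu>2 \<Longrightarrow> ratfun_eval r \<mu>1 \<mu>2 = c \<mu>1 \<mu>2"
proof -
  obtain p q where "\<And>\<mu>1 \<mu>2. off_lines M \<mu>1 \<mu>2 \<Longrightarrow> poly2 q \<mu>1 \<mu>2 \<noteq> 0 \<and> c \<mu>1 \<mu>2 = poly2 p \<mu>1 \<mu>2 / poly2 q \<mu>1 \<mu>2"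
    using assms unfolding rational_off_lines_def by blast
  then show thesis by (intro that[of "Fract p q"]) (simp_all add: ratfun_eval_Fract)
qed


section \<open>Kernels are smooth in the space variables\<close>

text \<open>
  A family of kernels that contains the Fourier kernels and is closed under \<open>t\<close>, \<open>s\<close> and both derivatives: the derivative
  of a Fourier kernel is again a Fourier kernel. It shows that all words in \<open>t\<close>, \<open>s\<close>, \<open>\<partial>/\<partial>t\<close>, \<open>\<partial>/\<partial>s\<close> may be applied to
  a kernel, which is needed since words distribute over sums only when the derivatives exist.
  Its members are kernels on the whole parameter space, so that continuity in \<open>\<mu>\<^sub>1\<close> passes to words as well.
\<close>

inductive_set kernel_space :: "kernel set" where
  fourier: "F \<in> test_functions \<Longrightarrow> fourier_kernel F \<in> kernel_space"
| add: "K \<in> kernel_space \<Longrightarrow> K' \<in> kernel_space \<Longrightarrow>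
    (\<lambda>t s \<mu>1 \<epsilon>1 \<mu>2 \<epsilon>2. K t s \<mu>1 \<epsilon>1 \<mu>2 \<epsilon>2 + K' t s \<mu>1 \<epsilon>1 \<mu>2 \<epsilon>2) \<in> kernel_space"
| mult_t: "K \<in> kernel_space \<Longrightarrow> (\<lambda>t s \<mu>1 \<epsilon>1 \<mu>2 \<epsilon>2. of_real t * K t s \<mu>1 \<epsilon>1 \<mu>2 \<epsilon>2) \<in> kernel_space"
| mult_s: "K \<in> kernel_space \<Longrightarrow> (\<lambda>t s \<mu>1 \<epsilon>1 \<mu>2 \<epsilon>2. of_real s * K t s \<mu>1 \<epsilon>1 \<mu>2 \<epsilon>2) \<in> kernel_space"

lemma kernel_space_dt:
  assumes "K \<in> kernel_space"
  shows "\<exists>K'\<in>kernel_space. \<forall>t s \<mu>1 \<epsilon>1 \<mu>2 \<epsilon>2.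
    ((\<lambda>t. K t s \<mu>1 \<epsilon>1 \<mu>2 \<epsilon>2) has_vector_derivative K' t s \<mu>1 \<epsilon>1 \<mu>2 \<epsilon>2) (at t)"
  using assms
proof induction
  case (fourier F)
  let ?G = "\<lambda>A. (- 1) * (entry 2 1 (partial 1 1 F) A + entry 2 2 (partial 1 2 F) A)"
  have "?G \<in> test_functions"
    by (intro test_function_scale test_function_add test_function_act fourier)
  moreover have "((\<lambda>t. fourier_kernel F t s \<mu>1 \<epsilon>1 \<mu>2 \<epsilon>2) has_vector_derivative fourier_kernel ?G t s \<mu>1 \<epsilon>1 \<mu>2 \<epsilon>2) (at t)"
    for t s \<mu>1 \<epsilon>1 \<mu>2 \<epsilon>2
    by (rule has_vector_derivative_eq_rhs[OF fourier_kernel_dt[OF fourier]],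
        simp only: fourier_kernel_scale fourier_kernel_add test_function_act fourier) simp
  ultimately show ?case using kernel_space.fourier by blast
next
  case (add K1 K2)
  then obtain K1' K2' where "K1' \<in> kernel_space" "K2' \<in> kernel_space"
    "\<And>t s \<mu>1 \<epsilon>1 \<mu>2 \<epsilon>2. ((\<lambda>t. K1 t s \<mu>1 \<epsilon>1 \<mu>2 \<epsilon>2) has_vector_derivative K1' t s \<mu>1 \<epsilon>1 \<mu>2 \<epsilon>2) (at t)"
    "\<And>t s \<mu>1 \<epsilon>1 \<mu>2 \<epsilon>2. ((\<lambda>t. K2 t s \<mu>1 \<epsilon>1 \<mu>2 \<epsilon>2) has_vector_derivative K2' t s \<mu>1 \<epsilon>1 \<mu>2 \<epsilon>2) (at t)"
    by blast
  then show ?case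
    by (intro bexI[OF _ kernel_space.add[of K1' K2']]) (auto intro: has_vector_derivative_add)
next
  case (mult_t K)
  then obtain K' where K': "K' \<in> kernel_space"
    "\<And>t s \<mu>1 \<epsilon>1 \<mu>2 \<epsilon>2. ((\<lambda>t. K t s \<mu>1 \<epsilon>1 \<mu>2 \<epsilon>2) has_vector_derivative K' t s \<mu>1 \<epsilon>1 \<mu>2 \<epsilon>2) (at t)"
    by blast
  have "((\<lambda>t. complex_of_real t) has_vector_derivative 1) (at t)" for t
    using has_vector_derivative_of_real[OF DERIV_ident] by simp
  from has_vector_derivative_mult[OF this K'(2)]
  show ?case
    by (intro bexI[OF _ kernel_space.add[OF kernel_space.mult_t[OF K'(1)] mult_t(1)]]) (auto simp: add.commute)
next
  case (mult_s K)
  then obtain K' where K': "K' \<in> kernel_space"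
    "\<And>t s \<mu>1 \<epsilon>1 \<mu>2 \<epsilon>2. ((\<lambda>t. K t s \<mu>1 \<epsilon>1 \<mu>2 \<epsilon>2) has_vector_derivative K' t s \<mu>1 \<epsilon>1 \<mu>2 \<epsilon>2) (at t)"
    by blast
  then show ?case
    by (intro bexI[OF _ kernel_space.mult_s[OF K'(1)]]) (auto intro: has_vector_derivative_mult_right)
qed

lemma kernel_space_ds:
  assumes "K \<in> kernel_space"
  shows "\<exists>K'\<in>kernel_space. \<forall>t s \<mu>1 \<epsilon>1 \<mu>2 \<epsilon>2.
    ((\<lambda>s. K t s \<mu>1 \<epsilon>1 \<mu>2 \<epsilon>2) has_vector_derivative K' t s \<mu>1 \<epsilon>1 \<mu>2 \<epsilon>2) (at s)"
  using assms
proof induction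
  case (fourier F)
  let ?G = "\<lambda>A. entry 1 1 (partial 1 2 F) A + entry 2 1 (partial 2 2 F) A"
  have "?G \<in> test_functions"
    by (intro test_function_add test_function_act fourier)
  moreover have "((\<lambda>s. fourier_kernel F t s \<mu>1 \<epsilon>1 \<mu>2 \<epsilon>2) has_vector_derivative fourier_kernel ?G t s \<mu>1 \<epsilon>1 \<mu>2 \<epsilon>2) (at s)"
    for t s \<mu>1 \<epsilon>1 \<mu>2 \<epsilon>2
    using fourier_kernel_ds[OF fourier]
    by (simp only: fourier_kernel_add test_function_act fourier)
  ultimately show ?case using kernel_space.fourier by blast
next
  case (add K1 K2)
  then obtain K1' K2' where "K1' \<in> kernel_space" "K2' \<in> kernel_space"
    "\<And>t s \<mu>1 \<epsilon>1 \<mu>2 \<epsilon>2. ((\<lambda>s. K1 t s \<mu>1 \<epsilon>1 \<mu>2 \<epsilon>2) has_vector_derivative K1' t s \<mu>1 \<epsilon>1 \<mu>2 \<epsilon>2) (at s)"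
    "\<And>t s \<mu>1 \<epsilon>1 \<mu>2 \<epsilon>2. ((\<lambda>s. K2 t s \<mu>1 \<epsilon>1 \<mu>2 \<epsilon>2) has_vector_derivative K2' t s \<mu>1 \<epsilon>1 \<mu>2 \<epsilon>2) (at s)"
    by blast
  then show ?case
    by (intro bexI[OF _ kernel_space.add[of K1' K2']]) (auto intro: has_vector_derivative_add)
next
  case (mult_s K)
  then obtain K' where K': "K' \<in> kernel_space"
    "\<And>t s \<mu>1 \<epsilon>1 \<mu>2 \<epsilon>2. ((\<lambda>s. K t s \<mu>1 \<epsilon>1 \<mu>2 \<epsilon>2) has_vector_derivative K' t s \<mu>1 \<epsilon>1 \<mu>2 \<epsilon>2) (at s)"
    by blast
  have "((\<lambda>s. complex_of_real s) has_vector_derivative 1) (at s)" for s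
    using has_vector_derivative_of_real[OF DERIV_ident] by simp
  from has_vector_derivative_mult[OF this K'(2)]
  show ?case
    by (intro bexI[OF _ kernel_space.add[OF kernel_space.mult_s[OF K'(1)] mult_s(1)]]) (auto simp: add.commute)
next
  case (mult_t K)
  then obtain K' where K': "K' \<in> kernel_space"
    "\<And>t s \<mu>1 \<epsilon>1 \<mu>2 \<epsilon>2. ((\<lambda>s. K t s \<mu>1 \<epsilon>1 \<mu>2 \<epsilon>2) has_vector_derivative K' t s \<mu>1 \<epsilon>1 \<mu>2 \<epsilon>2) (at s)"
    by blast
  then show ?case
    by (intro bexI[OF _ kernel_space.mult_t[OF K'(1)]]) (auto intro: has_vector_derivative_mult_right)
qed

lemma kernel_space_ts_act:
  assumes K: "K \<in> kernel_space"
  shows "\<exists>K'\<in>kernel_space. \<forall>\<mu>1 \<epsilon>1 \<mu>2 \<epsilon>2.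
    ts_act g (\<lambda>t s. K t s \<mu>1 \<epsilon>1 \<mu>2 \<epsilon>2) = (\<lambda>t s. K' t s \<mu>1 \<epsilon>1 \<mu>2 \<epsilon>2)"
proof (cases g)
  case Mult_t
  then show ?thesis by (intro bexI[OF _ kernel_space.mult_t[OF K]]) simp
next
  case Mult_s
  then show ?thesis by (intro bexI[OF _ kernel_space.mult_s[OF K]]) simp
next
  case Diff_t
  obtain K' where K': "K' \<in> kernel_space"
    "\<And>t s \<mu>1 \<epsilon>1 \<mu>2 \<epsilon>2. ((\<lambda>t. K t s \<mu>1 \<epsilon>1 \<mu>2 \<epsilon>2) has_vector_derivative K' t s \<mu>1 \<epsilon>1 \<mu>2 \<epsilon>2) (at t)"
    using kernel_space_dt[OF K] by blast
  show ?thesis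
    using Diff_t vector_derivative_at[OF K'(2)] by (intro bexI[OF _ K'(1)]) simp
next
  case Diff_s
  obtain K' where K': "K' \<in> kernel_space"
    "\<And>t s \<mu>1 \<epsilon>1 \<mu>2 \<epsilon>2. ((\<lambda>s. K t s \<mu>1 \<epsilon>1 \<mu>2 \<epsilon>2) has_vector_derivative K' t s \<mu>1 \<epsilon>1 \<mu>2 \<epsilon>2) (at s)"
    using kernel_space_ds[OF K] by blast
  show ?thesis
    using Diff_s vector_derivative_at[OF K'(2)] by (intro bexI[OF _ K'(1)]) simp
qed

lemma kernel_space_word:
  assumes "K \<in> kernel_space"
  obtains K' where "K' \<in> kernel_space"
    and "\<And>\<mu>1 \<epsilon>1 \<mu>2 \<epsilon>2. foldr ts_act x (\<lambda>t s. K t s \<mu>1 \<epsilon>1 \<mu>2 \<epsilon>2) = (\<lambda>t s. K' t s \<mu>1 \<epsilon>1 \<mu>2 \<epsilon>2)"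
proof -
  have "\<exists>K'\<in>kernel_space. \<forall>\<mu>1 \<epsilon>1 \<mu>2 \<epsilon>2.
      foldr ts_act x (\<lambda>t s. K t s \<mu>1 \<epsilon>1 \<mu>2 \<epsilon>2) = (\<lambda>t s. K' t s \<mu>1 \<epsilon>1 \<mu>2 \<epsilon>2)"
  proof (induction x)
    case Nil
    then show ?case using assms by (intro bexI[of _ K]) simp_all
  next
    case (Cons g x)
    then obtain K1 where "K1 \<in> kernel_space"
      "\<And>\<mu>1 \<epsilon>1 \<mu>2 \<epsilon>2. foldr ts_act x (\<lambda>t s. K t s \<mu>1 \<epsilon>1 \<mu>2 \<epsilon>2) = (\<lambda>t s. K1 t s \<mu>1 \<epsilon>1 \<mu>2 \<epsilon>2)" by blast
    then show ?case using kernel_space_ts_act[of K1 g] by simp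
  qed
  then show thesis using that by blast
qed

lemma kernel_space_continuous_\<mu>1:
  assumes "K \<in> kernel_space"
  shows "continuous_on UNIV (\<lambda>\<mu>1. K t s \<mu>1 \<epsilon>1 \<mu>2 \<epsilon>2)"
  using assms by induction (auto intro!: continuous_intros continuous_fourier_kernel_\<mu>1)

definition partially_differentiable :: "(real \<Rightarrow> real \<Rightarrow> complex) \<Rightarrow> bool" where
  "partially_differentiable f \<longleftrightarrow>
     (\<forall>t s. (\<lambda>t. f t s) differentiable (at t) \<and> (\<lambda>s. f t s) differentiable (at s))"

lemma partially_differentiable_word:
  assumes "F \<in> test_functions"
  shows "partially_differentiable (foldr ts_act x (\<lambda>t s. fourier_kernel F t s \<mu>1 \<epsilon>1 \<mu>2 \<epsilon>2))"
proof -
  obtain K where K: "K \<in> kernel_space"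
    "foldr ts_act x (\<lambda>t s. fourier_kernel F t s \<mu>1 \<epsilon>1 \<mu>2 \<epsilon>2) = (\<lambda>t s. K t s \<mu>1 \<epsilon>1 \<mu>2 \<epsilon>2)"
    using kernel_space_word[OF kernel_space.fourier[OF assms], of x] by metis
  show ?thesis
    unfolding K(2) partially_differentiable_def
    using kernel_space_dt[OF K(1)] kernel_space_ds[OF K(1)] by (meson differentiableI_vector)
qed

lemma partially_differentiable_0: "partially_differentiable (\<lambda>t s. 0)"
  by (simp add: partially_differentiable_def)

lemma partially_differentiable_add:
  "partially_differentiable f \<Longrightarrow> partially_differentiable g \<Longrightarrow> partially_differentiable (\<lambda>t s. f t s + g t s)"
  by (auto simp: partially_differentiable_def)

lemma partially_differentiable_scale:
  "partially_differentiable f \<Longrightarrow> partially_differentiable (\<lambda>t s. c * f t s)"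
  by (auto simp: partially_differentiable_def)

lemma ts_act_0: "ts_act g (\<lambda>t s. 0) = (\<lambda>t s. 0)"
  by (cases g) auto

lemma ts_act_add:
  "partially_differentiable f \<Longrightarrow> partially_differentiable h \<Longrightarrow>
    ts_act g (\<lambda>t s. f t s + h t s) = (\<lambda>t s. ts_act g f t s + ts_act g h t s)"
  by (cases g) (auto simp: partially_differentiable_def fun_eq_iff algebra_simps)

lemma ts_act_scale:
  "partially_differentiable f \<Longrightarrow> ts_act g (\<lambda>t s. c * f t s) = (\<lambda>t s. c * ts_act g f t s)"
  by (cases g) (auto simp: partially_differentiable_def fun_eq_iff algebra_simps
      vector_derivative_mult_at)


section \<open>Differential-difference operators as finite sums of terms\<close>

text \<open>
  A term \<open>(c, x, k, l)\<close> stands for \<open>c x V\<^sub>1\<^sup>k V\<^sub>2\<^sup>l\<close> with a coefficient \<open>c\<close> and a word \<open>x\<close> in \<open>t\<close>, \<open>s\<close>, \<open>\<partial>/\<partial>t\<close>, \<open>\<partial>/\<partial>s\<close>.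
\<close>

type_synonym dd_term = "(complex \<Rightarrow> complex \<Rightarrow> complex) \<times> ts_gen list \<times> int \<times> int"

abbreviation shift_kernel :: "int \<Rightarrow> int \<Rightarrow> kernel \<Rightarrow> kernel" where
  "shift_kernel k l K \<equiv> (\<lambda>t s \<mu>1 \<epsilon>1 \<mu>2 \<epsilon>2. K t s (\<mu>1 + of_int k) (\<epsilon>1 + of_int k) (\<mu>2 + of_int l) (\<epsilon>2 + of_int l))"

fun apply_term :: "dd_term \<Rightarrow> kernel \<Rightarrow> kernel" where
  "apply_term (c, x, k, l) K = (\<lambda>t s \<mu>1 \<epsilon>1 \<mu>2 \<epsilon>2. c \<mu>1 \<mu>2 *
     foldr ts_act x (\<lambda>t s. shift_kernel k l K t s \<mu>1 \<epsilon>1 \<mu>2 \<epsilon>2) t s)"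

definition apply_terms :: "dd_term list \<Rightarrow> kernel \<Rightarrow> kernel" where
  "apply_terms L K = (\<lambda>t s \<mu>1 \<epsilon>1 \<mu>2 \<epsilon>2. \<Sum>e\<leftarrow>L. apply_term e K t s \<mu>1 \<epsilon>1 \<mu>2 \<epsilon>2)"

text \<open>
  Any map \<open>T\<close> from test functions to kernels is admitted, not only \<open>T F = K\<^sub>D\<^sub>F\<close>; this makes sums, shifts and derivatives of
  representable maps meaningful, and an identity that expresses \<open>K\<^sub>D\<^sub>F\<close> through other such maps
  translates directly into representability.
\<close>

definition represents :: "int set \<Rightarrow> dd_term list \<Rightarrow> ((real^2^2 \<Rightarrow> complex) \<Rightarrow> kernel) \<Rightarrow> bool" where
  "represents M L T \<longleftrightarrow> finite M \<and> (\<forall>(c, x, k, l)\<in>set L. rational_off_lines M c) \<and>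
     (\<forall>F\<in>test_functions. \<forall>t s \<mu>1 \<epsilon>1 \<mu>2 \<epsilon>2. off_lines M \<mu>1 \<mu>2 \<longrightarrow>
        T F t s \<mu>1 \<epsilon>1 \<mu>2 \<epsilon>2 = apply_terms L (fourier_kernel F) t s \<mu>1 \<epsilon>1 \<mu>2 \<epsilon>2)"

definition representable :: "((real^2^2 \<Rightarrow> complex) \<Rightarrow> kernel) \<Rightarrow> bool" where
  "representable T \<longleftrightarrow> (\<exists>M L. represents M L T)"

lemma represents_mono:
  assumes "represents M L T" "M \<subseteq> M'" "finite M'"
  shows "represents M' L T"
proof -
  have "\<forall>(c, x, k, l)\<in>set L. rational_off_lines M' c"
    using assms(1) rational_off_lines_mono[OF _ assms(2)] unfolding represents_def by force
  then show ?thesis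
    using assms(1,3) off_lines_mono[OF _ assms(2)] by (simp add: represents_def)
qed

lemma representable_cong:
  assumes "representable T" and "finite M"
    and "\<And>F t s \<mu>1 \<epsilon>1 \<mu>2 \<epsilon>2. F \<in> test_functions \<Longrightarrow> off_lines M \<mu>1 \<mu>2 \<Longrightarrow>
      T' F t s \<mu>1 \<epsilon>1 \<mu>2 \<epsilon>2 = T F t s \<mu>1 \<epsilon>1 \<mu>2 \<epsilon>2"
  shows "representable T'"
proof -
  obtain M0 L where "represents M0 L T" using assms(1) by (auto simp: representable_def)
  then have "represents (M0 \<union> M) L T"
    using assms(2) by (intro represents_mono[of M0 L T "M0 \<union> M"]) (auto simp: represents_def)
  then have "represents (M0 \<union> M) L T'"
    using assms(3) off_lines_mono[of "M0 \<union> M" _ _ M] unfolding represents_def by auto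
  then show ?thesis by (auto simp: representable_def)
qed

lemma representable_fourier_kernel: "representable fourier_kernel"
proof -
  have "represents {} [(poly2 1, [], 0, 0)] fourier_kernel"
    by (simp add: represents_def apply_terms_def rational_off_lines_poly)
  then show ?thesis by (auto simp: representable_def)
qed

lemma representable_zero: "representable (\<lambda>F t s \<mu>1 \<epsilon>1 \<mu>2 \<epsilon>2. 0)"
proof -
  have "represents {} [] (\<lambda>F t s \<mu>1 \<epsilon>1 \<mu>2 \<epsilon>2. 0)"
    by (simp add: represents_def apply_terms_def)
  then show ?thesis by (auto simp: representable_def)
qed

lemma representable_add:
  assumes "representable T" "representable T'"
  shows "representable (\<lambda>F t s \<mu>1 \<epsilon>1 \<mu>2 \<epsilon>2. T F t s \<mu>1 \<epsilon>1 \<mu>2 \<epsilon>2 + T' F t s \<mu>1 \<epsilon>1 \<mu>2 \<epsilon>2)"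
proof -
  obtain M L M' L' where r: "represents M L T" "represents M' L' T'"
    using assms by (auto simp: representable_def)
  then have "finite (M \<union> M')" by (simp add: represents_def)
  then have "represents (M \<union> M') L T" "represents (M \<union> M') L' T'"
    using represents_mono[OF r(1), of "M \<union> M'"] represents_mono[OF r(2), of "M \<union> M'"] by simp_all
  then have "represents (M \<union> M') (L @ L') (\<lambda>F t s \<mu>1 \<epsilon>1 \<mu>2 \<epsilon>2. T F t s \<mu>1 \<epsilon>1 \<mu>2 \<epsilon>2 + T' F t s \<mu>1 \<epsilon>1 \<mu>2 \<epsilon>2)"
    unfolding represents_def by (auto simp: apply_terms_def)
  then show ?thesis by (auto simp: representable_def)
qed

lemma representable_coeff:
  assumes "representable T" "rational_off_lines M0 c0" "finite M0"
  shows "representable (\<lambda>F t s \<mu>1 \<epsilon>1 \<mu>2 \<epsilon>2. c0 \<mu>1 \<mu>2 * T F t s \<mu>1 \<epsilon>1 \<mu>2 \<epsilon>2)"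
proof -
  obtain M L where "represents M L T" using assms(1) by (auto simp: representable_def)
  then have r: "represents (M0 \<union> M) L T"
    using assms(3) by (intro represents_mono[of M L T "M0 \<union> M"]) (auto simp: represents_def)
  let ?L = "map (\<lambda>(c, x, k, l). (\<lambda>\<mu>1 \<mu>2. c0 \<mu>1 \<mu>2 * c \<mu>1 \<mu>2, x, k, l)) L"
  have "apply_terms ?L K t s \<mu>1 \<epsilon>1 \<mu>2 \<epsilon>2 = c0 \<mu>1 \<mu>2 * apply_terms L K t s \<mu>1 \<epsilon>1 \<mu>2 \<epsilon>2" for K t s \<mu>1 \<epsilon>1 \<mu>2 \<epsilon>2
    by (induction L) (auto simp: apply_terms_def algebra_simps)
  moreover have "rational_off_lines (M0 \<union> M) c0"
    using assms(2) by (rule rational_off_lines_mono) simp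
  then have "\<forall>(c, x, k, l)\<in>set ?L. rational_off_lines (M0 \<union> M) c"
    using r by (auto simp: represents_def intro!: rational_off_lines_mult)
  ultimately have "represents (M0 \<union> M) ?L (\<lambda>F t s \<mu>1 \<epsilon>1 \<mu>2 \<epsilon>2. c0 \<mu>1 \<mu>2 * T F t s \<mu>1 \<epsilon>1 \<mu>2 \<epsilon>2)"
    using r by (simp add: represents_def)
  then show ?thesis by (auto simp: representable_def)
qed

lemma representable_const:
  "representable T \<Longrightarrow> representable (\<lambda>F t s \<mu>1 \<epsilon>1 \<mu>2 \<epsilon>2. c * T F t s \<mu>1 \<epsilon>1 \<mu>2 \<epsilon>2)"
  using representable_coeff[of T "{}" "poly2 [:[:c:]:]"] rational_off_lines_poly by simp

lemma representable_uminus: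
  "representable T \<Longrightarrow> representable (\<lambda>F t s \<mu>1 \<epsilon>1 \<mu>2 \<epsilon>2. - T F t s \<mu>1 \<epsilon>1 \<mu>2 \<epsilon>2)"
  using representable_const[of T "- 1"] by simp

lemma representable_diff:
  "representable T \<Longrightarrow> representable T' \<Longrightarrow>
    representable (\<lambda>F t s \<mu>1 \<epsilon>1 \<mu>2 \<epsilon>2. T F t s \<mu>1 \<epsilon>1 \<mu>2 \<epsilon>2 - T' F t s \<mu>1 \<epsilon>1 \<mu>2 \<epsilon>2)"
  using representable_add[of T "\<lambda>F t s \<mu>1 \<epsilon>1 \<mu>2 \<epsilon>2. - T' F t s \<mu>1 \<epsilon>1 \<mu>2 \<epsilon>2"] representable_uminus[of T'] by simp

lemma representable_\<mu>1:
  "representable T \<Longrightarrow> representable (\<lambda>F t s \<mu>1 \<epsilon>1 \<mu>2 \<epsilon>2. (c + \<mu>1) * T F t s \<mu>1 \<epsilon>1 \<mu>2 \<epsilon>2)"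
  using representable_coeff[of T "{}" "poly2 [:[:c:], 1:]"] rational_off_lines_poly by simp

lemma representable_\<mu>2:
  "representable T \<Longrightarrow> representable (\<lambda>F t s \<mu>1 \<epsilon>1 \<mu>2 \<epsilon>2. (c + \<mu>2) * T F t s \<mu>1 \<epsilon>1 \<mu>2 \<epsilon>2)"
  using representable_coeff[of T "{}" "poly2 [:[:c, 1:]:]"] rational_off_lines_poly by simp

lemma representable_shift:
  assumes "representable T"
  shows "representable (\<lambda>F. shift_kernel k l (T F))"
proof -
  obtain M L where r: "represents M L T" using assms(1) by (auto simp: representable_def)
  let ?M = "(\<lambda>m. m - k + l) ` M"
  let ?L = "map (\<lambda>(c, x, k', l'). (\<lambda>\<mu>1 \<mu>2. c (\<mu>1 + of_int k) (\<mu>2 + of_int l), x, k + k', l + l')) L"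
  have "apply_terms ?L K t s \<mu>1 \<epsilon>1 \<mu>2 \<epsilon>2 = shift_kernel k l (apply_terms L K) t s \<mu>1 \<epsilon>1 \<mu>2 \<epsilon>2" for K t s \<mu>1 \<epsilon>1 \<mu>2 \<epsilon>2
    by (induction L) (auto simp: apply_terms_def add.assoc)
  moreover have "off_lines M (\<mu>1 + of_int k) (\<mu>2 + of_int l)" if "off_lines ?M \<mu>1 \<mu>2" for \<mu>1 \<mu>2
    using that by (force simp: off_lines_def algebra_simps)
  moreover have "\<forall>(c, x, k, l)\<in>set ?L. rational_off_lines ?M c"
    using r by (auto simp: represents_def intro!: rational_off_lines_shift)
  ultimately have "represents ?M ?L (\<lambda>F. shift_kernel k l (T F))"
    using r by (simp add: represents_def)
  then show ?thesis by (auto simp: representable_def)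
qed

lemma apply_terms_ts_act:
  assumes "F \<in> test_functions"
  shows "partially_differentiable (\<lambda>t s. apply_terms L (fourier_kernel F) t s \<mu>1 \<epsilon>1 \<mu>2 \<epsilon>2)"
    and "ts_act g (\<lambda>t s. apply_terms L (fourier_kernel F) t s \<mu>1 \<epsilon>1 \<mu>2 \<epsilon>2)
      = (\<lambda>t s. apply_terms (map (\<lambda>(c, x, k, l). (c, g # x, k, l)) L) (fourier_kernel F) t s \<mu>1 \<epsilon>1 \<mu>2 \<epsilon>2)"
proof (induction L)
  case Nil
  {
    case 1
    then show ?case by (simp add: apply_terms_def partially_differentiable_0)
  next
    case 2
    then show ?case by (simp add: apply_terms_def ts_act_0)
  }
next
  case (Cons e L)
  obtain c x k l where e: "e = (c, x, k, l)" by (cases e)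
  let ?w = "foldr ts_act x (\<lambda>t s. shift_kernel k l (fourier_kernel F) t s \<mu>1 \<epsilon>1 \<mu>2 \<epsilon>2)"
  have w: "partially_differentiable ?w" by (rule partially_differentiable_word[OF assms])
  have eq: "(\<lambda>t s. apply_terms (e # L) (fourier_kernel F) t s \<mu>1 \<epsilon>1 \<mu>2 \<epsilon>2)
      = (\<lambda>t s. c \<mu>1 \<mu>2 * ?w t s + apply_terms L (fourier_kernel F) t s \<mu>1 \<epsilon>1 \<mu>2 \<epsilon>2)"
    by (simp add: apply_terms_def e)
  {
    case 1
    show ?case unfolding eq
      by (intro partially_differentiable_add partially_differentiable_scale w Cons.IH)
  next
    case 2
    show ?case unfolding eq
      by (simp only: ts_act_add partially_differentiable_scale w Cons.IH ts_act_scale)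
         (simp add: apply_terms_def e case_prod_unfold o_def)
  }
qed

text \<open>
  The exceptional lines concern \<open>\<mu>\<^sub>1\<close>, \<open>\<mu>\<^sub>2\<close> only, so off them the representation is an identity of functions
  of \<open>t\<close> and \<open>s\<close> and may be differentiated.
\<close>

lemma representable_ts_act:
  assumes "representable T"
  shows "representable (\<lambda>F t s \<mu>1 \<epsilon>1 \<mu>2 \<epsilon>2. ts_act g (\<lambda>t s. T F t s \<mu>1 \<epsilon>1 \<mu>2 \<epsilon>2) t s)"
proof -
  obtain M L where r: "represents M L T" using assms(1) by (auto simp: representable_def)
  let ?L = "map (\<lambda>(c, x, k, l). (c, g # x, k, l)) L"
  have "ts_act g (\<lambda>t s. T F t s \<mu>1 \<epsilon>1 \<mu>2 \<epsilon>2) = (\<lambda>t s. apply_terms ?L (fourier_kernel F) t s \<mu>1 \<epsilon>1 \<mu>2 \<epsilon>2)"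
    if "F \<in> test_functions" "off_lines M \<mu>1 \<mu>2" for F \<mu>1 \<epsilon>1 \<mu>2 \<epsilon>2
  proof -
    have "(\<lambda>t s. T F t s \<mu>1 \<epsilon>1 \<mu>2 \<epsilon>2) = (\<lambda>t s. apply_terms L (fourier_kernel F) t s \<mu>1 \<epsilon>1 \<mu>2 \<epsilon>2)"
      using r that by (simp add: represents_def)
    then show ?thesis by (simp only: apply_terms_ts_act(2)[OF that(1)])
  qed
  moreover have "\<forall>(c, x, k, l)\<in>set ?L. rational_off_lines M c"
    using r by (auto simp: represents_def)
  ultimately have "represents M ?L (\<lambda>F t s \<mu>1 \<epsilon>1 \<mu>2 \<epsilon>2. ts_act g (\<lambda>t s. T F t s \<mu>1 \<epsilon>1 \<mu>2 \<epsilon>2) t s)"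
    using r by (simp add: represents_def)
  then show ?thesis by (auto simp: representable_def)
qed


section \<open>Polynomial differential operators have representable images\<close>

lemma representable_entry21:
  assumes D: "\<And>F. F \<in> test_functions \<Longrightarrow> D F \<in> test_functions"
    and T: "representable (\<lambda>F. fourier_kernel (D F))"
  shows "representable (\<lambda>F. fourier_kernel (entry 2 1 (D F)))"
proof (rule representable_cong[where M = "{0}"])
  show "representable (\<lambda>F t s \<mu>1 \<epsilon>1 \<mu>2 \<epsilon>2. 1 / (\<mu>1 - \<mu>2) *
     (ts_act Diff_t (\<lambda>t s. shift_kernel 1 0 (fourier_kernel (D F)) t s \<mu>1 \<epsilon>1 \<mu>2 \<epsilon>2) t s
      + ts_act Diff_s (\<lambda>t s. shift_kernel 0 1 (fourier_kernel (D F)) t s \<mu>1 \<epsilon>1 \<mu>2 \<epsilon>2) t s))"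
    by (intro representable_coeff[OF _ rational_off_lines_inverse_diff] representable_add
        representable_ts_act representable_shift T) simp
  show "fourier_kernel (entry 2 1 (D F)) t s \<mu>1 \<epsilon>1 \<mu>2 \<epsilon>2 = 1 / (\<mu>1 - \<mu>2) *
     (ts_act Diff_t (\<lambda>t s. shift_kernel 1 0 (fourier_kernel (D F)) t s \<mu>1 \<epsilon>1 \<mu>2 \<epsilon>2) t s
      + ts_act Diff_s (\<lambda>t s. shift_kernel 0 1 (fourier_kernel (D F)) t s \<mu>1 \<epsilon>1 \<mu>2 \<epsilon>2) t s)"
    if "F \<in> test_functions" "off_lines {0} \<mu>1 \<mu>2" for F t s \<mu>1 \<epsilon>1 \<mu>2 \<epsilon>2
    using fourier_kernel_entry21[OF D[OF that(1)], of \<mu>1 \<mu>2 t s \<epsilon>1 \<epsilon>2] that(2)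
    by (simp add: off_lines_def field_simps)
qed simp

lemma representable_entry:
  assumes D: "\<And>F. F \<in> test_functions \<Longrightarrow> D F \<in> test_functions"
    and T: "representable (\<lambda>F. fourier_kernel (D F))"
  shows "representable (\<lambda>F. fourier_kernel (entry i j (D F)))"
proof -
  note 21 = representable_entry21[OF D T]
  have 11: "representable (\<lambda>F. fourier_kernel (entry 1 1 (D F)))"
  proof (rule representable_cong[where M = "{}"])
    show "representable (\<lambda>F t s \<mu>1 \<epsilon>1 \<mu>2 \<epsilon>2. shift_kernel 1 0 (fourier_kernel (D F)) t s \<mu>1 \<epsilon>1 \<mu>2 \<epsilon>2
       - ts_act Mult_t (\<lambda>t s. fourier_kernel (entry 2 1 (D F)) t s \<mu>1 \<epsilon>1 \<mu>2 \<epsilon>2) t s)"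
      by (intro representable_diff representable_ts_act representable_shift T 21)
  qed (simp_all add: fourier_kernel_shift1 D)
  have 22: "representable (\<lambda>F. fourier_kernel (entry 2 2 (D F)))"
  proof (rule representable_cong[where M = "{}"])
    show "representable (\<lambda>F t s \<mu>1 \<epsilon>1 \<mu>2 \<epsilon>2. shift_kernel 0 1 (fourier_kernel (D F)) t s \<mu>1 \<epsilon>1 \<mu>2 \<epsilon>2
       + ts_act Mult_s (\<lambda>t s. fourier_kernel (entry 2 1 (D F)) t s \<mu>1 \<epsilon>1 \<mu>2 \<epsilon>2) t s)"
      by (intro representable_add representable_ts_act representable_shift T 21)
  qed (simp_all add: fourier_kernel_shift2 D)
  have 12: "representable (\<lambda>F. fourier_kernel (entry 1 2 (D F)))"
  proof (rule representable_cong[where M = "{}"])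
    show "representable (\<lambda>F t s \<mu>1 \<epsilon>1 \<mu>2 \<epsilon>2.
         ts_act Mult_s (\<lambda>t s. fourier_kernel (entry 1 1 (D F)) t s \<mu>1 \<epsilon>1 \<mu>2 \<epsilon>2) t s
       - ts_act Mult_t (\<lambda>t s. fourier_kernel (entry 2 2 (D F)) t s \<mu>1 \<epsilon>1 \<mu>2 \<epsilon>2) t s
       + ts_act Mult_s (\<lambda>t s. ts_act Mult_t (\<lambda>t s. fourier_kernel (entry 2 1 (D F)) t s \<mu>1 \<epsilon>1 \<mu>2 \<epsilon>2) t s) t s)"
      by (intro representable_add representable_diff representable_ts_act 11 21 22)
  qed (simp_all add: fourier_kernel_entry12 D)
  show ?thesis using exhaust_2[of i] exhaust_2[of j] 11 12 21 22 by auto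
qed

lemma representable_partial:
  assumes D: "\<And>F. F \<in> test_functions \<Longrightarrow> D F \<in> test_functions"
    and T: "representable (\<lambda>F. fourier_kernel (D F))"
  shows "representable (\<lambda>F. fourier_kernel (partial i j (D F)))"
proof -
  have 12: "representable (\<lambda>F. fourier_kernel (partial 1 2 (D F)))"
  proof (rule representable_cong[where M = "{}"])
    show "representable (\<lambda>F t s \<mu>1 \<epsilon>1 \<mu>2 \<epsilon>2.
         ts_act Diff_s (\<lambda>t s. shift_kernel (- 1) 0 (fourier_kernel (D F)) t s \<mu>1 \<epsilon>1 \<mu>2 \<epsilon>2) t s
       + (- 3/2 + \<mu>2) * shift_kernel (- 1) (- 1) (fourier_kernel (entry 2 1 (D F))) t s \<mu>1 \<epsilon>1 \<mu>2 \<epsilon>2)"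
      by (intro representable_add representable_\<mu>2 representable_ts_act representable_shift
          representable_entry D T)
  qed (simp_all add: fourier_kernel_partial12 D)
  have 11: "representable (\<lambda>F. fourier_kernel (partial 1 1 (D F)))"
  proof (rule representable_cong[where M = "{}"])
    show "representable (\<lambda>F t s \<mu>1 \<epsilon>1 \<mu>2 \<epsilon>2.
       - ((- 3/2 + \<mu>1) * shift_kernel (- 1) 0 (fourier_kernel (D F)) t s \<mu>1 \<epsilon>1 \<mu>2 \<epsilon>2)
       - ts_act Mult_s (\<lambda>t s. fourier_kernel (partial 1 2 (D F)) t s \<mu>1 \<epsilon>1 \<mu>2 \<epsilon>2) t s)"
      by (intro representable_uminus representable_diff representable_\<mu>1 representable_ts_act representable_shift T 12)
  next
    fix F t s \<mu>1 \<epsilon>1 \<mu>2 \<epsilon>2 assume "F \<in> test_functions"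
    from fourier_kernel_by_parts(1)[OF D[OF this], of t s \<mu>1 \<epsilon>1 \<mu>2 \<epsilon>2]
    show "fourier_kernel (partial 1 1 (D F)) t s \<mu>1 \<epsilon>1 \<mu>2 \<epsilon>2 =
       - ((- 3/2 + \<mu>1) * shift_kernel (- 1) 0 (fourier_kernel (D F)) t s \<mu>1 \<epsilon>1 \<mu>2 \<epsilon>2)
       - ts_act Mult_s (\<lambda>t s. fourier_kernel (partial 1 2 (D F)) t s \<mu>1 \<epsilon>1 \<mu>2 \<epsilon>2) t s"
      by (simp add: eq_diff_eq)
  qed simp
  have 22: "representable (\<lambda>F. fourier_kernel (partial 2 2 (D F)))"
  proof (rule representable_cong[where M = "{}"])
    show "representable (\<lambda>F t s \<mu>1 \<epsilon>1 \<mu>2 \<epsilon>2.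
       - ((- 3/2 + \<mu>2) * shift_kernel 0 (- 1) (fourier_kernel (D F)) t s \<mu>1 \<epsilon>1 \<mu>2 \<epsilon>2)
       + ts_act Mult_t (\<lambda>t s. fourier_kernel (partial 1 2 (D F)) t s \<mu>1 \<epsilon>1 \<mu>2 \<epsilon>2) t s)"
      by (intro representable_uminus representable_add representable_\<mu>2 representable_ts_act representable_shift T 12)
  next
    fix F t s \<mu>1 \<epsilon>1 \<mu>2 \<epsilon>2 assume "F \<in> test_functions"
    from fourier_kernel_by_parts(3)[OF D[OF this], of t s \<mu>1 \<epsilon>1 \<mu>2 \<epsilon>2]
    show "fourier_kernel (partial 2 2 (D F)) t s \<mu>1 \<epsilon>1 \<mu>2 \<epsilon>2 =
       - ((- 3/2 + \<mu>2) * shift_kernel 0 (- 1) (fourier_kernel (D F)) t s \<mu>1 \<epsilon>1 \<mu>2 \<epsilon>2)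
       + ts_act Mult_t (\<lambda>t s. fourier_kernel (partial 1 2 (D F)) t s \<mu>1 \<epsilon>1 \<mu>2 \<epsilon>2) t s"
      by (simp add: diff_eq_eq)
  qed simp
  have 21: "representable (\<lambda>F. fourier_kernel (partial 2 1 (D F)))"
  proof (rule representable_cong[where M = "{}"])
    show "representable (\<lambda>F t s \<mu>1 \<epsilon>1 \<mu>2 \<epsilon>2.
       ts_act Mult_t (\<lambda>t s. fourier_kernel (partial 1 1 (D F)) t s \<mu>1 \<epsilon>1 \<mu>2 \<epsilon>2
         + ts_act Mult_s (\<lambda>t s. fourier_kernel (partial 1 2 (D F)) t s \<mu>1 \<epsilon>1 \<mu>2 \<epsilon>2) t s) t s
       - ts_act Mult_s (\<lambda>t s. fourier_kernel (partial 2 2 (D F)) t s \<mu>1 \<epsilon>1 \<mu>2 \<epsilon>2) t s)"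
      by (intro representable_diff representable_ts_act representable_add 11 12 22)
  next
    fix F t s \<mu>1 \<epsilon>1 \<mu>2 \<epsilon>2 assume "F \<in> test_functions"
    from fourier_kernel_by_parts(2)[OF D[OF this], of t s \<mu>1 \<epsilon>1 \<mu>2 \<epsilon>2]
    show "fourier_kernel (partial 2 1 (D F)) t s \<mu>1 \<epsilon>1 \<mu>2 \<epsilon>2 =
       ts_act Mult_t (\<lambda>t s. fourier_kernel (partial 1 1 (D F)) t s \<mu>1 \<epsilon>1 \<mu>2 \<epsilon>2
         + ts_act Mult_s (\<lambda>t s. fourier_kernel (partial 1 2 (D F)) t s \<mu>1 \<epsilon>1 \<mu>2 \<epsilon>2) t s) t s
       - ts_act Mult_s (\<lambda>t s. fourier_kernel (partial 2 2 (D F)) t s \<mu>1 \<epsilon>1 \<mu>2 \<epsilon>2) t s"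
      by (simp add: eq_diff_eq)
  qed simp
  show ?thesis using exhaust_2[of i] exhaust_2[of j] 11 12 21 22 by auto
qed

lemma representable_word: "representable (\<lambda>F. fourier_kernel (foldr gl2_act x F))"
proof (induction x)
  case Nil
  show ?case using representable_fourier_kernel by simp
next
  case (Cons g x)
  note D = test_function_word[of _ x]
  show ?case
  proof (cases g)
    case (Entry i j)
    then show ?thesis using representable_entry[OF D Cons.IH] by simp
  next
    case Inv_det
    have "representable (\<lambda>F. fourier_kernel (gl2_act Inv_det (foldr gl2_act x F)))"
      by (rule representable_cong[OF representable_shift[OF Cons.IH, of "- 1" "- 1"], where M = "{}"])
         (simp_all add: fourier_kernel_inv_det D)
    then show ?thesis using Inv_det by simp
  next
    case (Partial i j)
    then show ?thesis using representable_partial[OF D Cons.IH] by simp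
  qed
qed

lemma test_function_gl2_poly_op: "F \<in> test_functions \<Longrightarrow> gl2_poly_op P F \<in> test_functions"
  unfolding gl2_poly_op_def by (intro test_function_sum test_function_scale test_function_word)

lemma representable_sum:
  assumes "\<And>x. x \<in> X \<Longrightarrow> representable (T x)"
  shows "representable (\<lambda>F t s \<mu>1 \<epsilon>1 \<mu>2 \<epsilon>2. \<Sum>x\<in>X. T x F t s \<mu>1 \<epsilon>1 \<mu>2 \<epsilon>2)"
  using assms
proof (induction X rule: infinite_finite_induct)
  case (insert x X)
  then show ?case using representable_add[of "T x"] by simp
qed (simp_all add: representable_zero)

lemma representable_gl2_poly_op: "representable (\<lambda>F. fourier_kernel (gl2_poly_op P F))"
proof (rule representable_cong[where M = "{}"])
  show "representable (\<lambda>F t s \<mu>1 \<epsilon>1 \<mu>2 \<epsilon>2. \<Sum>x\<in>Poly_Mapping.keys P. Poly_Mapping.lookup P x * fourier_kernel (foldr gl2_act x F) t s \<mu>1 \<epsilon>1 \<mu>2 \<epsilon>2)"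
    by (intro representable_sum representable_const representable_word)
qed (simp_all add: gl2_poly_op_def fourier_kernel_sum fourier_kernel_scale test_function_scale test_function_word)


section \<open>Collecting terms\<close>

text \<open>
  A family \<open>h\<close> indexed by the integers that starts at the identity and advances by \<open>f\<close> consists of the integer
  powers of \<open>f\<close>.
\<close>

lemma int_funpow_inverse:
  assumes "\<And>x. f (g x) = x" "\<And>x. g (f x) = x"
    and "\<And>k x. h (k + 1) x = f (h k x)" "\<And>x. h 0 x = x"
  shows "int_funpow f k x = h k x"
proof -
  have g: "h (k - 1) x = g (h k x)" for k x
    using assms(3)[of "k - 1" x] assms(2) by simp
  have "inv f = g" using assms(1,2) by (intro inv_equality) auto
  moreover have "(f ^^ n) x = h (int n) x" for n
    by (induction n) (simp_all add: assms(3,4) add.commute[of 1])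
  moreover have "(g ^^ n) x = h (- int n) x" for n
  proof (induction n)
    case (Suc n)
    have "- int (Suc n) = - int n - 1" by simp
    then show ?case using Suc g[of "- int n" x] by (simp only: funpow.simps o_apply)
  qed (simp add: assms(4))
  ultimately show ?thesis by (simp add: int_funpow_def)
qed

lemma int_funpow_V1: "int_funpow V1 k K = shift_kernel k 0 K"
  by (rule int_funpow_inverse[where g = "shift_kernel (- 1) 0" and h = "\<lambda>k. shift_kernel k 0"])
     (simp_all add: V1_def fun_eq_iff algebra_simps)

lemma int_funpow_V2: "int_funpow V2 l K = shift_kernel 0 l K"
  by (rule int_funpow_inverse[where g = "shift_kernel 0 (- 1)" and h = "\<lambda>l. shift_kernel 0 l"])
     (simp_all add: V2_def fun_eq_iff algebra_simps)

lemma int_funpow_V1_V2: "int_funpow V1 k (int_funpow V2 l K) = shift_kernel k l K"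
  by (simp add: int_funpow_V1 int_funpow_V2)

lemma ts_poly_op_superset:
  assumes "finite X" "Poly_Mapping.keys Q \<subseteq> X"
  shows "ts_poly_op Q K t s \<mu>1 \<epsilon>1 \<mu>2 \<epsilon>2 = (\<Sum>x\<in>X. ratfun_eval (Poly_Mapping.lookup Q x) \<mu>1 \<mu>2 *
        foldr ts_act x (\<lambda>t' s'. K t' s' \<mu>1 \<epsilon>1 \<mu>2 \<epsilon>2) t s)"
  unfolding ts_poly_op_def
  by (rule sum.mono_neutral_left) (use assms in \<open>auto simp: ratfun_eval_0 in_keys_iff\<close>)

lemma ts_poly_op_add:
  assumes "\<And>x. regular_at (Poly_Mapping.lookup Q x) \<mu>1 \<mu>2" "\<And>x. regular_at (Poly_Mapping.lookup Q' x) \<mu>1 \<mu>2"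
  shows "ts_poly_op (Q + Q') K t s \<mu>1 \<epsilon>1 \<mu>2 \<epsilon>2 =
    ts_poly_op Q K t s \<mu>1 \<epsilon>1 \<mu>2 \<epsilon>2 + ts_poly_op Q' K t s \<mu>1 \<epsilon>1 \<mu>2 \<epsilon>2"
proof -
  let ?X = "Poly_Mapping.keys Q \<union> Poly_Mapping.keys Q'"
  have "Poly_Mapping.keys (Q + Q') \<subseteq> ?X" by (rule keys_add)
  then show ?thesis
    by (simp add: ts_poly_op_superset[of ?X] lookup_add ratfun_eval_add assms sum.distrib distrib_right)
qed

lemma ts_poly_op_0: "ts_poly_op 0 K t s \<mu>1 \<epsilon>1 \<mu>2 \<epsilon>2 = 0"
  by (simp add: ts_poly_op_def)

lemma ts_poly_op_single:
  "ts_poly_op (Poly_Mapping.single x r) K t s \<mu>1 \<epsilon>1 \<mu>2 \<epsilon>2 =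
     ratfun_eval r \<mu>1 \<mu>2 * foldr ts_act x (\<lambda>t' s'. K t' s' \<mu>1 \<epsilon>1 \<mu>2 \<epsilon>2) t s"
  by (subst ts_poly_op_superset[of "{x}"]) auto

fun collect_coeffs :: "(ratfun \<times> ts_gen list \<times> int \<times> int) list \<Rightarrow> int \<Rightarrow> int \<Rightarrow> (ts_gen list \<Rightarrow>\<^sub>0 ratfun)" where
  "collect_coeffs [] k l = 0"
| "collect_coeffs ((r, x, k', l') # L) k l = (if (k, l) = (k', l') then Poly_Mapping.single x r else 0) + collect_coeffs L k l"

lemma regular_at_collect:
  assumes "\<And>r x k l. (r, x, k, l) \<in> set L \<Longrightarrow> regular_at r \<mu>1 \<mu>2"
  shows "regular_at (Poly_Mapping.lookup (collect_coeffs L k l) x) \<mu>1 \<mu>2"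
  using assms
proof (induction L k l rule: collect_coeffs.induct)
  case (2 r x' k' l' L k l)
  have "regular_at (Poly_Mapping.lookup (if (k, l) = (k', l') then Poly_Mapping.single x' r else 0) x) \<mu>1 \<mu>2"
    using "2.prems" by (auto simp: lookup_single when_def regular_at_0)
  then show ?case
    unfolding collect_coeffs.simps lookup_add using 2 by (intro ratfun_eval_add(1)) auto
qed (simp add: regular_at_0)

lemma shift_poly_op_collect:
  assumes "\<And>r x k l. (r, x, k, l) \<in> set L \<Longrightarrow> regular_at r \<mu>1 \<mu>2"
    and "finite I" "\<And>r x k l. (r, x, k, l) \<in> set L \<Longrightarrow> (k, l) \<in> I"
  shows "shift_poly_op I (collect_coeffs L) K t s \<mu>1 \<epsilon>1 \<mu>2 \<epsilon>2 =
    apply_terms (map (\<lambda>(r, x, k, l). (ratfun_eval r, x, k, l)) L) K t s \<mu>1 \<epsilon>1 \<mu>2 \<epsilon>2"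
  using assms(1,3)
proof (induction L)
  case Nil
  then show ?case by (simp add: shift_poly_op_def apply_terms_def ts_poly_op_0)
next
  case (Cons e L)
  obtain r x k l where e: "e = (r, x, k, l)" by (cases e)
  let ?S = "\<lambda>k l. int_funpow V1 k (int_funpow V2 l K)"
  let ?e = "\<lambda>k' l'. if (k', l') = (k, l) then Poly_Mapping.single x r else 0"
  have "ts_poly_op (collect_coeffs (e # L) k' l') (?S k' l') t s \<mu>1 \<epsilon>1 \<mu>2 \<epsilon>2
      = ts_poly_op (?e k' l') (?S k' l') t s \<mu>1 \<epsilon>1 \<mu>2 \<epsilon>2 + ts_poly_op (collect_coeffs L k' l') (?S k' l') t s \<mu>1 \<epsilon>1 \<mu>2 \<epsilon>2" for k' l'
    unfolding e collect_coeffs.simps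
    using Cons.prems(1) e
    by (intro ts_poly_op_add regular_at_collect) (auto simp: lookup_single when_def regular_at_0)
  then have "shift_poly_op I (collect_coeffs (e # L)) K t s \<mu>1 \<epsilon>1 \<mu>2 \<epsilon>2 =
      (\<Sum>(k', l')\<in>I. ts_poly_op (?e k' l') (?S k' l') t s \<mu>1 \<epsilon>1 \<mu>2 \<epsilon>2) + shift_poly_op I (collect_coeffs L) K t s \<mu>1 \<epsilon>1 \<mu>2 \<epsilon>2"
    by (simp add: shift_poly_op_def case_prod_unfold sum.distrib)
  also have "(\<Sum>(k', l')\<in>I. ts_poly_op (?e k' l') (?S k' l') t s \<mu>1 \<epsilon>1 \<mu>2 \<epsilon>2) =
      (\<Sum>p\<in>I. if p = (k, l) then ts_poly_op (Poly_Mapping.single x r) (?S k l) t s \<mu>1 \<epsilon>1 \<mu>2 \<epsilon>2 else 0)"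
    by (rule sum.cong) (auto simp: ts_poly_op_0 split: if_splits)
  also have "\<dots> = ts_poly_op (Poly_Mapping.single x r) (?S k l) t s \<mu>1 \<epsilon>1 \<mu>2 \<epsilon>2"
    using assms(2) Cons.prems(2)[of r x k l] e by simp
  also have "\<dots> = apply_term (ratfun_eval r, x, k, l) K t s \<mu>1 \<epsilon>1 \<mu>2 \<epsilon>2"
    by (simp add: ts_poly_op_single int_funpow_V1_V2)
  also have "shift_poly_op I (collect_coeffs L) K t s \<mu>1 \<epsilon>1 \<mu>2 \<epsilon>2 =
      apply_terms (map (\<lambda>(r, x, k, l). (ratfun_eval r, x, k, l)) L) K t s \<mu>1 \<epsilon>1 \<mu>2 \<epsilon>2"
  proof (rule Cons.IH)
    show "regular_at r \<mu>1 \<mu>2" if "(r, x, k, l) \<in> set L" for r x k l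
      using Cons.prems(1) that by (meson list.set_intros(2))
    show "(k, l) \<in> I" if "(r, x, k, l) \<in> set L" for r x k l
      using Cons.prems(2) that by (meson list.set_intros(2))
  qed
  finally show ?case by (simp add: e apply_terms_def)
qed

text \<open>
  Outside the poles of the collected coefficients both ingredients of each summand are continuous in \<open>\<mu>\<^sub>1\<close>.
  This holds in particular at points of lines on which all poles have cancelled.
\<close>

lemma isCont_shift_poly_op:
  assumes F: "F \<in> test_functions" and "(\<mu>1, \<mu>2) \<notin> coeff_poles I Q"
  shows "isCont (\<lambda>z. shift_poly_op I Q (fourier_kernel F) t s z \<epsilon>1 \<mu>2 \<epsilon>2) \<mu>1"
proof -
  have word: "isCont (\<lambda>z. foldr ts_act x (\<lambda>t s. shift_kernel k l (fourier_kernel F) t s z \<epsilon>1 \<mu>2 \<epsilon>2) t s) \<mu>1" for x k l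
  proof -
    obtain K where K: "K \<in> kernel_space"
      "\<And>\<mu>1 \<epsilon>1 \<mu>2 \<epsilon>2. foldr ts_act x (\<lambda>t s. fourier_kernel F t s \<mu>1 \<epsilon>1 \<mu>2 \<epsilon>2) = (\<lambda>t s. K t s \<mu>1 \<epsilon>1 \<mu>2 \<epsilon>2)"
      using kernel_space_word[OF kernel_space.fourier[OF F], of x] by metis
    have "continuous_on UNIV (\<lambda>z. K t s (z + of_int k) (\<epsilon>1 + of_int k) (\<mu>2 + of_int l) (\<epsilon>2 + of_int l))"
      by (rule continuous_on_compose2[OF kernel_space_continuous_\<mu>1[OF K(1)]]) (auto intro!: continuous_intros)
    then show ?thesis by (simp add: K(2) continuous_on_eq_continuous_at)
  qed
  have "isCont (\<lambda>z. ts_poly_op (Q k l) (shift_kernel k l (fourier_kernel F)) t s z \<epsilon>1 \<mu>2 \<epsilon>2) \<mu>1"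
    if "(k, l) \<in> I" for k l
  proof -
    have "regular_at (Poly_Mapping.lookup (Q k l) x) \<mu>1 \<mu>2" if "x \<in> Poly_Mapping.keys (Q k l)" for x
      using assms(2) \<open>(k, l) \<in> I\<close> that unfolding coeff_poles_def regular_at_def by blast
    then show ?thesis
      unfolding ts_poly_op_def by (intro continuous_intros isCont_ratfun_eval word)
  qed
  then show ?thesis
    unfolding shift_poly_op_def case_prod_unfold int_funpow_V1_V2
    by (intro continuous_intros) (metis prod.collapse)
qed

theorem theorem2:
  fixes D :: "(real^2^2 \<Rightarrow> complex) \<Rightarrow> (real^2^2 \<Rightarrow> complex)"
  assumes "polynomial_diff_op D"
  shows "\<exists>(I :: (int \<times> int) set) (Q :: int \<Rightarrow> int \<Rightarrow> (ts_gen list \<Rightarrow>\<^sub>0 ratfun)).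
           finite I \<and>
           (\<forall>(k, l)\<in>I. \<forall>x. poles_at_integer_lines (Poly_Mapping.lookup (Q k l) x)) \<and>
           is_fourier_image D (coeff_poles I Q) (shift_poly_op I Q)"
proof -
  obtain P where P: "\<And>F. F \<in> test_functions \<Longrightarrow> D F = gl2_poly_op P F"
    using assms by (auto simp: polynomial_diff_op_def)
  have "representable (\<lambda>F. fourier_kernel (D F))"
    by (rule representable_cong[OF representable_gl2_poly_op[of P], where M = "{}"]) (simp_all add: P)
  then obtain M L where "represents M L (\<lambda>F. fourier_kernel (D F))" by (auto simp: representable_def)
  then have M: "finite M" and L: "\<And>c x k l. (c, x, k, l) \<in> set L \<Longrightarrow> rational_off_lines M c"
    and eq: "\<And>F t s \<mu>1 \<epsilon>1 \<mu>2 \<epsilon>2. F \<in> test_functions \<Longrightarrow> off_lines M \<mu>1 \<mu>2 \<Longrightarrow>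
      fourier_kernel (D F) t s \<mu>1 \<epsilon>1 \<mu>2 \<epsilon>2 = apply_terms L (fourier_kernel F) t s \<mu>1 \<epsilon>1 \<mu>2 \<epsilon>2"
    by (auto simp: represents_def)
  have "\<forall>c. \<exists>r. rational_off_lines M c \<longrightarrow>
      (\<forall>\<mu>1 \<mu>2. off_lines M \<mu>1 \<mu>2 \<longrightarrow> regular_at r \<mu>1 \<mu>2 \<and> ratfun_eval r \<mu>1 \<mu>2 = c \<mu>1 \<mu>2)"
    using rational_off_lines_ratfun by metis
  then obtain r where r: "\<And>c \<mu>1 \<mu>2. rational_off_lines M c \<Longrightarrow> off_lines M \<mu>1 \<mu>2 \<Longrightarrow>
      regular_at (r c) \<mu>1 \<mu>2 \<and> ratfun_eval (r c) \<mu>1 \<mu>2 = c \<mu>1 \<mu>2"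
    by metis
  define L' where "L' = map (\<lambda>(c, x, k, l). (r c, x, k, l)) L"
  define I where "I = (\<lambda>(c, x, k, l). (k, l)) ` set L"
  define Q where "Q = collect_coeffs L'"
  have "finite I" by (simp add: I_def)
  have reg: "regular_at q \<mu>1 \<mu>2" if "(q, x, k, l) \<in> set L'" "off_lines M \<mu>1 \<mu>2" for q x k l \<mu>1 \<mu>2
    using that r L by (auto simp: L'_def)
  have "poles_at_integer_lines (Poly_Mapping.lookup (Q k l) x)" for k l x
    unfolding poles_at_integer_lines_def
  proof (intro exI conjI subsetI)
    fix p assume p: "p \<in> polar_set (Poly_Mapping.lookup (Q k l) x)"
    obtain \<mu>1 \<mu>2 where "p = (\<mu>1, \<mu>2)" by (cases p)
    with p have "\<not> off_lines M \<mu>1 \<mu>2"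
      using regular_at_collect[of L' \<mu>1 \<mu>2 k l x] reg by (auto simp: Q_def regular_at_def)
    then show "p \<in> (\<Union>m\<in>M. {(\<mu>1, \<mu>2). \<mu>1 - \<mu>2 = of_int m})"
      by (auto simp: off_lines_def \<open>p = (\<mu>1, \<mu>2)\<close>)
  qed (rule M)
  moreover have "is_fourier_image D (coeff_poles I Q) (shift_poly_op I Q)"
    unfolding is_fourier_image_def
  proof (intro ballI allI impI)
    fix F t s \<mu>1 \<epsilon>1 \<mu>2 \<epsilon>2
    assume F: "F \<in> test_functions" and nopole: "(\<mu>1, \<mu>2) \<notin> coeff_poles I Q"
    let ?lhs = "\<lambda>z. fourier_kernel (D F) t s z \<epsilon>1 \<mu>2 \<epsilon>2"
    let ?rhs = "\<lambda>z. shift_poly_op I Q (fourier_kernel F) t s z \<epsilon>1 \<mu>2 \<epsilon>2"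
    have off: "?lhs z = ?rhs z" if z: "off_lines M z \<mu>2" for z
    proof -
      have "?rhs z = apply_terms (map (\<lambda>(r, x, k, l). (ratfun_eval r, x, k, l)) L') (fourier_kernel F) t s z \<epsilon>1 \<mu>2 \<epsilon>2"
        unfolding Q_def
      proof (rule shift_poly_op_collect)
        show "regular_at q z \<mu>2" if "(q, x, k, l) \<in> set L'" for q x k l using reg that z by blast
        show "(k, l) \<in> I" if "(q, x, k, l) \<in> set L'" for q x k l
          using that by (force simp: L'_def I_def)
      qed fact
      also have "\<dots> = apply_terms L (fourier_kernel F) t s z \<epsilon>1 \<mu>2 \<epsilon>2"
        unfolding apply_terms_def L'_def map_map o_def
        by (rule arg_cong[of _ _ sum_list], rule map_cong) (use r L z in auto)
      finally show ?thesis using eq[OF F z] by simp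
    qed
    (* For fixed \<mu>2 only finitely many values of \<mu>1 lie on the exceptional lines, so the two sides
       agree in a punctured neighbourhood of \<mu>1, and by continuity at \<mu>1 itself. *)
    have "eventually (\<lambda>z. z \<notin> (\<lambda>m. \<mu>2 + of_int m) ` M) (at \<mu>1)"
      using M by (metis finite_imageI islimpt_finite islimpt_iff_eventually)
    then have "eventually (\<lambda>z. ?lhs z = ?rhs z) (at \<mu>1)"
    proof eventually_elim
      case (elim z)
      then have "off_lines M z \<mu>2" by (auto simp: off_lines_def image_iff diff_eq_eq add.commute)
      then show ?case by (rule off)
    qed
    then have "(?rhs \<longlongrightarrow> l) (at \<mu>1) \<longleftrightarrow> (?lhs \<longlongrightarrow> l) (at \<mu>1)" for l
      by (intro tendsto_cong) (simp add: eq_commute)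
    moreover have "(?lhs \<longlongrightarrow> ?lhs \<mu>1) (at \<mu>1)"
      using continuous_fourier_kernel_\<mu>1[OF test_function_gl2_poly_op[OF F, of P]] P[OF F]
      by (simp add: continuous_on_eq_continuous_at isCont_def)
    moreover have "(?rhs \<longlongrightarrow> ?rhs \<mu>1) (at \<mu>1)"
      using isCont_shift_poly_op[OF F nopole] by (simp add: isCont_def)
    ultimately show "?lhs \<mu>1 = ?rhs \<mu>1"
      using LIM_unique[of ?rhs "?lhs \<mu>1" \<mu>1 "?rhs \<mu>1"] by blast
  qed
  ultimately show ?thesis using \<open>finite I\<close> by blast
qed

end
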